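(* Let $\phi$ be a nonconstant inner function on $\mathbb{D}^2$, let $\alpha\in\mathbb{T}$, and let $J_\alpha\colon K_\phi\to L^2(\sigma_\alpha)$ be the Clark embedding. Then its adjoint $J_\alpha^*\colon L^2(\sigma_\alpha)\to K_\phi$ is given by $$(J_\alpha^*h)(z)=(1-\bar\alpha\,\phi(z))\int_{\mathbb{T}^2}h(\zeta)\,k_\zeta(z)\,d\sigma_\alpha(\zeta)$$ for all $h\in L^2(\sigma_\alpha)$ and $z\in\mathbb{D}^2$.
   Context: $\mathbb{D}$ is the open unit disk, $\mathbb{T}$ the unit circle. $H^2(\mathbb{D}^2)$ is the Hardy space of holomorphic $f=\sum_{k,l\ge0}a_{k,l}z_1^kz_2^l$ on $\mathbb{D}^2$ with $\|f\|^2=\sum|a_{k,l}|^2<\infty$. A function $\phi$ is inner on $\mathbb{D}^2$ if it is bounded and holomorphic on $\mathbb{D}^2$ with non-tangential boundary values of modulus $1$ a.e. on $\mathbb{T}^2$. The model space is $K_\phi=H^2(\mathbb{D}^2)\ominus\phi H^2(\mathbb{D}^2)$. Kernels: $k_w(z)=\frac{1}{(1-z_1\bar w_1)(1-z_2\bar w_2)}$ (also used for $w=\zeta\in\mathbb{T}^2$, $z\in\mathbb{D}^2$), and $k_w^\phi(z)=\frac{1-\phi(z)\overline{\phi(w)}}{(1-z_1\bar w_1)(1-z_2\bar w_2)}$ is the reproducing kernel of $K_\phi$. Clark measure: for $\alpha\in\mathbb{T}$, $\sigma_\alpha$ is the positive Borel measure on $\mathbb{T}^2$ with $\frac{1-|\phi(z)|^2}{|\alpha-\phi(z)|^2}=\int_{\mathbb{T}^2}P_{z_1}(\zeta_1)P_{z_2}(\zeta_2)\,d\sigma_\alpha(\zeta)$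 for all $z\in\mathbb{D}^2$, where $P_{z_j}(\zeta_j)=\frac{1-|z_j|^2}{|\zeta_j-z_j|^2}$. Clark embedding: $J_\alpha\colon K_\phi\to L^2(\sigma_\alpha)$ is the linear isometry (known to exist, not necessarily surjective) determined by $J_\alpha k_w^\phi=(1-\alpha\overline{\phi(w)})\,k_w$ for all $w\in\mathbb{D}^2$, where on the right $k_w$ is regarded as a function on $\mathbb{T}^2$. *)

theory Defs
  imports "HOL-Analysis.Analysis"
begin

definition bidisk :: "(complex \<times> complex) set"
  where "bidisk = ball 0 1 \<times> ball 0 1"

definition torus :: "(complex \<times> complex) set"
  where "torus = sphere 0 1 \<times> sphere 0 1"

text \<open>Normalised Lebesgue measure on the torus, as a Borel measure on the ambient space.\<close>

definition torus_measure :: "(complex \<times> complex) measure"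
  where "torus_measure =
    distr (uniform_measure lborel ({0..2 * pi} \<times> {0..2 * pi})) borel (\<lambda>(s, t). (cis s, cis t))"


subsection \<open>Inner functions\<close>

text \<open>Holomorphy in two variables: Frechet differentiability with a complex-linear derivative.\<close>

definition holomorphic2_on ::
    "(complex \<times> complex \<Rightarrow> complex) \<Rightarrow> (complex \<times> complex) set \<Rightarrow> bool"
  where "holomorphic2_on f S \<longleftrightarrow>
    (\<forall>z\<in>S. \<exists>a b. (f has_derivative (\<lambda>(u, v). a * u + b * v)) (at z within S))"

definition stolz_region :: "real \<Rightarrow> complex \<Rightarrow> complex set"
  where "stolz_region \<beta> \<zeta> = {z \<in> ball 0 1. cmod (z - \<zeta>) < \<beta> * (1 - cmod z)}"

text \<open>In two variables an approach region is a product of Stolz regions; the two coordinates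
  may tend to the boundary at independent rates.\<close>

definition has_nontangential_limit ::
    "(complex \<times> complex \<Rightarrow> complex) \<Rightarrow> complex \<times> complex \<Rightarrow> complex \<Rightarrow> bool"
  where "has_nontangential_limit f \<zeta> L \<longleftrightarrow>
    (\<forall>\<beta>>1. (f \<longlongrightarrow> L) (at \<zeta> within stolz_region \<beta> (fst \<zeta>) \<times> stolz_region \<beta> (snd \<zeta>)))"

definition inner_function :: "(complex \<times> complex \<Rightarrow> complex) \<Rightarrow> bool"
  where "inner_function \<phi> \<longleftrightarrow>
    holomorphic2_on \<phi> bidisk \<and> bounded (\<phi> ` bidisk) \<and>
    (AE \<zeta> in torus_measure. \<exists>L. has_nontangential_limit \<phi> \<zeta> L \<and> cmod L = 1)"


subsection \<open>The Hardy space and the model space\<close>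

text \<open>Functions on the bidisk are represented by total functions whose values off the bidisk are
  irrelevant: no notion below depends on them.\<close>

definition has_power_series ::
    "(complex \<times> complex \<Rightarrow> complex) \<Rightarrow> (nat \<times> nat \<Rightarrow> complex) \<Rightarrow> bool"
  where "has_power_series f a \<longleftrightarrow>
    (\<forall>z\<in>bidisk. ((\<lambda>(k, l). a (k, l) * fst z ^ k * snd z ^ l) has_sum f z) UNIV)"

definition power_series_coeff :: "(complex \<times> complex \<Rightarrow> complex) \<Rightarrow> nat \<times> nat \<Rightarrow> complex"
  where "power_series_coeff f = (THE a. has_power_series f a)"

text \<open>Holomorphy need not be required separately: a power series that converges on the bidisk has
  a holomorphic sum.\<close>

definition hardy_space :: "(complex \<times> complex \<Rightarrow> complex) set"
  where "hardy_space =
    {f. \<exists>a. has_power_series f a \<and> (\<lambda>n. (cmod (a n))\<^sup>2) summable_on UNIV}"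

definition hardy_inner ::
    "(complex \<times> complex \<Rightarrow> complex) \<Rightarrow> (complex \<times> complex \<Rightarrow> complex) \<Rightarrow> complex"
  where "hardy_inner f g = (\<Sum>\<^sub>\<infinity>n. power_series_coeff f n * cnj (power_series_coeff g n))"

definition hardy_norm :: "(complex \<times> complex \<Rightarrow> complex) \<Rightarrow> real"
  where "hardy_norm f = sqrt (\<Sum>\<^sub>\<infinity>n. (cmod (power_series_coeff f n))\<^sup>2)"

definition model_space ::
    "(complex \<times> complex \<Rightarrow> complex) \<Rightarrow> (complex \<times> complex \<Rightarrow> complex) set"
  where "model_space \<phi> =
    {f \<in> hardy_space. \<forall>g\<in>hardy_space. hardy_inner f (\<lambda>z. \<phi> z * g z) = 0}"

definition szego_kernel :: "complex \<times> complex \<Rightarrow> complex \<times> complex \<Rightarrow> complex"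
  where "szego_kernel w z = 1 / ((1 - fst z * cnj (fst w)) * (1 - snd z * cnj (snd w)))"

definition model_kernel ::
    "(complex \<times> complex \<Rightarrow> complex) \<Rightarrow> complex \<times> complex \<Rightarrow> complex \<times> complex \<Rightarrow> complex"
  where "model_kernel \<phi> w z =
    (1 - \<phi> z * cnj (\<phi> w)) / ((1 - fst z * cnj (fst w)) * (1 - snd z * cnj (snd w)))"


subsection \<open>Clark measures and the Clark embedding\<close>

definition poisson_kernel :: "complex \<Rightarrow> complex \<Rightarrow> real"
  where "poisson_kernel z \<zeta> = (1 - (cmod z)\<^sup>2) / (cmod (\<zeta> - z))\<^sup>2"

definition clark_measure ::
    "(complex \<times> complex \<Rightarrow> complex) \<Rightarrow> complex \<Rightarrow> (complex \<times> complex) measure \<Rightarrow> bool"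
  where "clark_measure \<phi> \<alpha> \<sigma> \<longleftrightarrow>
    sets \<sigma> = sets (restrict_space borel torus) \<and>
    (\<forall>z\<in>bidisk.
      ennreal ((1 - (cmod (\<phi> z))\<^sup>2) / (cmod (\<alpha> - \<phi> z))\<^sup>2) =
      (\<integral>\<^sup>+ \<zeta>. ennreal (poisson_kernel (fst z) (fst \<zeta>) * poisson_kernel (snd z) (snd \<zeta>)) \<partial>\<sigma>))"

text \<open>Elements of \<open>L\<^sup>2\<close> are represented by square-integrable functions, so that equality in \<open>L\<^sup>2\<close> is
  equality almost everywhere.\<close>

definition L2_space :: "'a measure \<Rightarrow> ('a \<Rightarrow> complex) set"
  where "L2_space M = {h \<in> borel_measurable M. integrable M (\<lambda>x. (cmod (h x))\<^sup>2)}"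

definition L2_inner :: "'a measure \<Rightarrow> ('a \<Rightarrow> complex) \<Rightarrow> ('a \<Rightarrow> complex) \<Rightarrow> complex"
  where "L2_inner M g h = (\<integral>x. g x * cnj (h x) \<partial>M)"

definition L2_norm :: "'a measure \<Rightarrow> ('a \<Rightarrow> complex) \<Rightarrow> real"
  where "L2_norm M h = sqrt (\<integral>x. (cmod (h x))\<^sup>2 \<partial>M)"

definition clark_embedding ::
    "(complex \<times> complex \<Rightarrow> complex) \<Rightarrow> complex \<Rightarrow> (complex \<times> complex) measure \<Rightarrow>
     ((complex \<times> complex \<Rightarrow> complex) \<Rightarrow> (complex \<times> complex \<Rightarrow> complex)) \<Rightarrow> bool"
  where "clark_embedding \<phi> \<alpha> \<sigma> J \<longleftrightarrow>
    (\<forall>f\<in>model_space \<phi>. J f \<in> L2_space \<sigma>) \<and>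
    (\<forall>f\<in>model_space \<phi>. \<forall>g\<in>model_space \<phi>. AE \<zeta> in \<sigma>. J (\<lambda>z. f z + g z) \<zeta> = J f \<zeta> + J g \<zeta>) \<and>
    (\<forall>c. \<forall>f\<in>model_space \<phi>. AE \<zeta> in \<sigma>. J (\<lambda>z. c * f z) \<zeta> = c * J f \<zeta>) \<and>
    (\<forall>f\<in>model_space \<phi>. L2_norm \<sigma> (J f) = hardy_norm f) \<and>
    (\<forall>w\<in>bidisk. AE \<zeta> in \<sigma>.
      J (model_kernel \<phi> w) \<zeta> = (1 - \<alpha> * cnj (\<phi> w)) * szego_kernel w \<zeta>)"

text \<open>\<open>S\<close> is the Hilbert space adjoint of the operator \<open>J\<close> from the model space into \<open>L\<^sup>2\<close>.\<close>

definition is_adjoint ::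
    "(complex \<times> complex \<Rightarrow> complex) \<Rightarrow> (complex \<times> complex) measure \<Rightarrow>
     ((complex \<times> complex \<Rightarrow> complex) \<Rightarrow> (complex \<times> complex \<Rightarrow> complex)) \<Rightarrow>
     ((complex \<times> complex \<Rightarrow> complex) \<Rightarrow> (complex \<times> complex \<Rightarrow> complex)) \<Rightarrow> bool"
  where "is_adjoint \<phi> \<sigma> J S \<longleftrightarrow>
    (\<forall>h\<in>L2_space \<sigma>. S h \<in> model_space \<phi> \<and>
      (\<forall>f\<in>model_space \<phi>. L2_inner \<sigma> (J f) h = hardy_inner f (S h)))"

end

theory Submission
  imports Defs "HOL-Complex_Analysis.Cauchy_Integral_Formula"
begin

text \<open>By Riesz representation in the model space, realised as a closed subspace of the sequence space of
  Taylor coefficients, the bounded map \<open>J\<close> has an adjoint. Testing it against the reproducing kernels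
  gives \<open>(J\<^sup>* h)(w) = \<langle>J\<^sup>* h, k\<^sub>w\<^sup>\<phi>\<rangle> = \<langle>h, J k\<^sub>w\<^sup>\<phi>\<rangle>\<close>, and the last inner product is the
  claimed integral. What has to be shown is that \<open>k\<^sub>w\<^sup>\<phi>\<close> lies in the model space and reproduces point values
  there; this amounts to multiplication by \<open>\<phi>\<close> being an isometry of the Hardy space. For a polynomial \<open>p\<close>,
  Parseval's identity on the tori of radius \<open>r < 1\<close> and dominated convergence as \<open>r\<close> tends to \<open>1\<close> express the
  norms of \<open>\<phi> p\<close> and of \<open>p\<close> by the same boundary integral, because \<open>\<phi>\<close> is unimodular on the torus almost
  everywhere; density of the polynomials gives the general case.\<close>

subsection \<open>The complex sequence space\<close>

text \<open>Two descriptions of functions have to be matched: the Hardy space is given by Taylor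
  coefficients, whereas \<phi> is inner through its limits at the torus. The comparison is confined
  to products of \<phi> with a polynomial p because the boundary limit of the squared modulus of
  \<phi> p is then the explicit continuous function |p|^2; a general Hardy space element is never
  given boundary values. That \<phi> p has a double power series at all comes from boundedness and
  holomorphy in each variable separately. A second obstacle is that functions are total: J acts on
  representatives, which may differ off the bidisk, and J is linear only almost everywhere. Both
  defects vanish inside the inner product with h, since integrals ignore null sets and a function
  that is zero on the bidisk has Hardy norm zero, hence image zero almost everywhere by
  isometry.\<close>

lemma square_summable_mult:
  fixes a b :: "'i \<Rightarrow> complex"
  assumes "(\<lambda>n. (cmod (a n))\<^sup>2) summable_on A" "(\<lambda>n. (cmod (b n))\<^sup>2) summable_on A"
  shows "(\<lambda>n. cmod (a n * b n)) summable_on A"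
  by (rule abs_summable_product) (use assms in \<open>simp_all add: norm_mult power2_eq_square\<close>)

lemma square_summable_add:
  fixes a b :: "'i \<Rightarrow> complex"
  assumes "(\<lambda>n. (cmod (a n))\<^sup>2) summable_on A" "(\<lambda>n. (cmod (b n))\<^sup>2) summable_on A"
  shows "(\<lambda>n. (cmod (a n + b n))\<^sup>2) summable_on A"
proof (rule summable_on_comparison_test)
  show "(\<lambda>n. 2 * (cmod (a n))\<^sup>2 + 2 * (cmod (b n))\<^sup>2) summable_on A"
    by (intro summable_on_add summable_on_cmult_right assms)
  show "(cmod (a n + b n))\<^sup>2 \<le> 2 * (cmod (a n))\<^sup>2 + 2 * (cmod (b n))\<^sup>2" for n
  proof -
    have "(cmod (a n + b n))\<^sup>2 \<le> (cmod (a n) + cmod (b n))\<^sup>2"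
      by (intro power_mono norm_triangle_ineq) simp
    also have "\<dots> \<le> 2 * (cmod (a n))\<^sup>2 + 2 * (cmod (b n))\<^sup>2"
      using zero_le_power2[of "cmod (a n) - cmod (b n)"] unfolding power2_diff power2_sum by linarith
    finally show ?thesis .
  qed
qed simp

lemma square_summable_cmult:
  fixes a :: "'i \<Rightarrow> complex"
  assumes "(\<lambda>n. (cmod (a n))\<^sup>2) summable_on A"
  shows "(\<lambda>n. (cmod (c * a n))\<^sup>2) summable_on A"
  using summable_on_cmult_right[OF assms, of "(cmod c)\<^sup>2"] by (simp add: norm_mult power_mult_distrib)

text \<open>A type of its own lets norm, limits, closedness and completeness come from type classes.
  Elements of the Hardy space, as total functions, are determined only up to their values off the
  bidisk and cannot carry a norm directly.\<close>

typedef 'i ell2 = "{a :: 'i \<Rightarrow> complex. (\<lambda>n. (cmod (a n))\<^sup>2) summable_on UNIV}"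
  morphisms coef Ell2
  by (rule exI[of _ "\<lambda>_. 0"]) simp

setup_lifting type_definition_ell2

lemma coef_summable: "(\<lambda>n. (cmod (coef a n))\<^sup>2) summable_on UNIV"
  using coef[of a] by simp

lemma coef_Ell2: "(\<lambda>n. (cmod (a n))\<^sup>2) summable_on UNIV \<Longrightarrow> coef (Ell2 a) = a"
  by (simp add: Ell2_inverse)

lift_definition cmul :: "complex \<Rightarrow> 'i ell2 \<Rightarrow> 'i ell2" is "\<lambda>c a n. c * a n"
  by (rule square_summable_cmult)

definition cinner :: "'i ell2 \<Rightarrow> 'i ell2 \<Rightarrow> complex"
  where "cinner a b = (\<Sum>\<^sub>\<infinity>n. coef a n * cnj (coef b n))"

lemma cinner_summable: "(\<lambda>n. coef a n * cnj (coef b n)) summable_on UNIV"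
  by (rule abs_summable_summable, rule square_summable_mult) (simp_all add: coef_summable)

lemma Re_cinner_self: "Re (cinner a a) = (\<Sum>\<^sub>\<infinity>n. (cmod (coef a n))\<^sup>2)"
  unfolding cinner_def infsum_Re[OF cinner_summable, symmetric]
  by (simp add: complex_norm_square[symmetric] flip: of_real_power)

text \<open>The class provides a real inner product, so \<open>inner\<close> is the real part of
  \<open>cinner\<close>; the complex structure is kept alongside it in \<open>cmul\<close> and
  \<open>cinner\<close>.\<close>

instantiation ell2 :: (type) real_inner
begin

lift_definition zero_ell2 :: "'a ell2" is "\<lambda>_. 0" by simp
lift_definition plus_ell2 :: "'a ell2 \<Rightarrow> 'a ell2 \<Rightarrow> 'a ell2" is "\<lambda>a b n. a n + b n"
  by (rule square_summable_add)
lift_definition uminus_ell2 :: "'a ell2 \<Rightarrow> 'a ell2" is "\<lambda>a n. - a n" by simp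
lift_definition minus_ell2 :: "'a ell2 \<Rightarrow> 'a ell2 \<Rightarrow> 'a ell2" is "\<lambda>a b n. a n - b n"
  using square_summable_add[of _ UNIV "\<lambda>n. - _ n"] by force
lift_definition scaleR_ell2 :: "real \<Rightarrow> 'a ell2 \<Rightarrow> 'a ell2" is "\<lambda>c a n. complex_of_real c * a n"
  by (rule square_summable_cmult)

definition inner_ell2 :: "'a ell2 \<Rightarrow> 'a ell2 \<Rightarrow> real" where "inner_ell2 a b = Re (cinner a b)"
definition norm_ell2 :: "'a ell2 \<Rightarrow> real" where "norm_ell2 a = sqrt (inner a a)"
definition dist_ell2 :: "'a ell2 \<Rightarrow> 'a ell2 \<Rightarrow> real" where "dist_ell2 a b = norm (a - b)"
definition sgn_ell2 :: "'a ell2 \<Rightarrow> 'a ell2" where "sgn_ell2 a = scaleR (inverse (norm a)) a"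
definition uniformity_ell2 :: "('a ell2 \<times> 'a ell2) filter"
  where "uniformity_ell2 = (INF e\<in>{0<..}. principal {(x, y). dist x y < e})"
definition open_ell2 :: "'a ell2 set \<Rightarrow> bool"
  where "open_ell2 U = (\<forall>x\<in>U. eventually (\<lambda>(x', y). x' = x \<longrightarrow> y \<in> U) uniformity)"

instance
proof
  fix x y z :: "'a ell2" and r s :: real
  show "x + y + z = x + (y + z)" "x + y = y + x" "0 + x = x" "- x + x = 0" "x - y = x + - y"
    "r *\<^sub>R (x + y) = r *\<^sub>R x + r *\<^sub>R y" "(r + s) *\<^sub>R x = r *\<^sub>R x + s *\<^sub>R x"
    "r *\<^sub>R s *\<^sub>R x = (r * s) *\<^sub>R x" "1 *\<^sub>R x = x"
    by (transfer; simp add: fun_eq_iff algebra_simps)+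
  show "inner x y = inner y x"
  proof -
    have "cinner x y = cnj (cinner y x)"
      unfolding cinner_def infsum_cnj[symmetric] by (simp add: mult.commute)
    then show ?thesis by (simp add: inner_ell2_def)
  qed
  show "inner (x + y) z = inner x z + inner y z"
    unfolding inner_ell2_def cinner_def plus_complex.sel(1)[symmetric]
    by (subst infsum_add[symmetric]) (simp_all add: cinner_summable plus_ell2.rep_eq algebra_simps)
  show "inner (r *\<^sub>R x) y = r * inner x y"
  proof -
    have "cinner (r *\<^sub>R x) y = of_real r * cinner x y"
      unfolding cinner_def by (subst infsum_cmult_right'[symmetric]) (simp add: scaleR_ell2.rep_eq algebra_simps)
    then show ?thesis by (simp add: inner_ell2_def)
  qed
  have *: "inner x x = (\<Sum>\<^sub>\<infinity>n. (cmod (coef x n))\<^sup>2)"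
    by (simp add: inner_ell2_def Re_cinner_self)
  show "0 \<le> inner x x" unfolding * by (rule infsum_nonneg) simp
  show "inner x x = 0 \<longleftrightarrow> x = 0"
  proof
    assume "inner x x = 0"
    then have "(cmod (coef x n))\<^sup>2 = 0" for n
      by (intro nonneg_infsum_le_0D[where A = UNIV and f = "\<lambda>n. (cmod (coef x n))\<^sup>2"])
        (simp_all add: * coef_summable)
    then show "x = 0" by (intro coef_inject[THEN iffD1]) (auto simp: zero_ell2.rep_eq)
  next
    assume "x = 0"
    then show "inner x x = 0" unfolding * by (simp add: zero_ell2.rep_eq)
  qed
qed (simp_all add: norm_ell2_def dist_ell2_def sgn_ell2_def uniformity_ell2_def open_ell2_def)

end

lemmas coef_simps [simp] =
  zero_ell2.rep_eq plus_ell2.rep_eq uminus_ell2.rep_eq minus_ell2.rep_eq scaleR_ell2.rep_eq cmul.rep_eq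

lemma ell2_eqI: "(\<And>n. coef a n = coef b n) \<Longrightarrow> a = b"
  by (simp add: coef_inject[symmetric] fun_eq_iff)

lemma norm_ell2_sq: "(norm a)\<^sup>2 = (\<Sum>\<^sub>\<infinity>n. (cmod (coef a n))\<^sup>2)"
  by (simp add: power2_norm_eq_inner inner_ell2_def Re_cinner_self)

lemma sum_coef_le_norm: "finite F \<Longrightarrow> (\<Sum>n\<in>F. (cmod (coef a n))\<^sup>2) \<le> (norm a)\<^sup>2"
  unfolding norm_ell2_sq by (rule finite_sum_le_infsum) (simp_all add: coef_summable)

lemma cmod_coef_le_norm: "cmod (coef a n) \<le> norm a"
  using sum_coef_le_norm[of "{n}" a] by (simp add: power2_le_iff_abs_le)

lemma norm_ell2_leI:
  assumes "\<And>F. finite F \<Longrightarrow> (\<Sum>n\<in>F. (cmod (coef a n))\<^sup>2) \<le> e\<^sup>2" "0 \<le> e"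
  shows "norm a \<le> e"
proof -
  have "(norm a)\<^sup>2 \<le> e\<^sup>2"
    unfolding norm_ell2_sq by (rule infsum_le_finite_sums) (use assms in \<open>simp_all add: coef_summable\<close>)
  then show ?thesis using assms(2) by (rule power2_le_imp_le)
qed

instance ell2 :: (type) complete_space
proof
  fix X :: "nat \<Rightarrow> 'a ell2" assume X: "Cauchy X"
  have "Cauchy (\<lambda>k. coef (X k) n)" for n
  proof (rule metric_CauchyI)
    fix e :: real assume "e > 0"
    then obtain M where M: "\<And>k m. k \<ge> M \<Longrightarrow> m \<ge> M \<Longrightarrow> dist (X k) (X m) < e"
      using metric_CauchyD[OF X] by blast
    have "dist (coef (X k) n) (coef (X m) n) \<le> dist (X k) (X m)" for k m
      using cmod_coef_le_norm[of "X k - X m" n] by (simp add: dist_norm)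
    then show "\<exists>M. \<forall>m\<ge>M. \<forall>k\<ge>M. dist (coef (X m) n) (coef (X k) n) < e"
      using M by (meson order_le_less_trans)
  qed
  then have "\<forall>n. \<exists>l. (\<lambda>k. coef (X k) n) \<longlonglongrightarrow> l"
    using Cauchy_convergent convergent_def by blast
  then obtain L where L: "\<And>n. (\<lambda>k. coef (X k) n) \<longlonglongrightarrow> L n" by metis
  \<comment> \<open>Quantifying over finite F inside the bound is what allows the limit in the
    second index: finite sums pass to the limit term by term, and the estimate is uniform in
    F.\<close>
  have *: "\<exists>M. \<forall>k\<ge>M. \<forall>F. finite F \<longrightarrow> (\<Sum>n\<in>F. (cmod (coef (X k) n - L n))\<^sup>2) \<le> e\<^sup>2" if e: "e > 0" for e
  proof -
    obtain M where M: "\<And>k m. k \<ge> M \<Longrightarrow> m \<ge> M \<Longrightarrow> dist (X k) (X m) < e"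
      using metric_CauchyD[OF X e] by blast
    have "(\<Sum>n\<in>F. (cmod (coef (X k) n - L n))\<^sup>2) \<le> e\<^sup>2" if k: "k \<ge> M" and F: "finite F" for k F
    proof (rule tendsto_upperbound)
      show "(\<lambda>m. \<Sum>n\<in>F. (cmod (coef (X k) n - coef (X m) n))\<^sup>2) \<longlonglongrightarrow> (\<Sum>n\<in>F. (cmod (coef (X k) n - L n))\<^sup>2)"
        by (intro tendsto_intros L)
      show "\<forall>\<^sub>F m in sequentially. (\<Sum>n\<in>F. (cmod (coef (X k) n - coef (X m) n))\<^sup>2) \<le> e\<^sup>2"
      proof (rule eventually_sequentiallyI)
        fix m assume m: "M \<le> m"
        have "(\<Sum>n\<in>F. (cmod (coef (X k) n - coef (X m) n))\<^sup>2) \<le> (norm (X k - X m))\<^sup>2"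
          using sum_coef_le_norm[OF F, of "X k - X m"] by simp
        also have "\<dots> \<le> e\<^sup>2"
          using M[OF k m] by (intro power_mono) (simp_all add: dist_norm)
        finally show "(\<Sum>n\<in>F. (cmod (coef (X k) n - coef (X m) n))\<^sup>2) \<le> e\<^sup>2" .
      qed
    qed simp
    then show ?thesis by blast
  qed
  have diff: "(\<lambda>n. (cmod (coef (X k) n - L n))\<^sup>2) summable_on UNIV"
    if "\<forall>F. finite F \<longrightarrow> (\<Sum>n\<in>F. (cmod (coef (X k) n - L n))\<^sup>2) \<le> e\<^sup>2" for k e
    by (rule nonneg_bdd_above_summable_on) (use that in \<open>auto intro!: bdd_aboveI2\<close>)
  \<comment> \<open>L is square-summable because it is one member X k of the sequence minus the
    square-summable difference of X k and L.\<close>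
  obtain k where "\<forall>F. finite F \<longrightarrow> (\<Sum>n\<in>F. (cmod (coef (X k) n - L n))\<^sup>2) \<le> 1\<^sup>2"
    using *[of 1] by auto
  then have "(\<lambda>n. (cmod (coef (X k) n + - (coef (X k) n - L n)))\<^sup>2) summable_on UNIV"
    by (intro square_summable_add coef_summable) (simp only: norm_minus_cancel diff)
  then have "coef (Ell2 L) = L" by (simp add: coef_Ell2)
  have "X \<longlonglongrightarrow> Ell2 L"
  proof (rule metric_LIMSEQ_I)
    fix e :: real assume "e > 0"
    then obtain M where M: "\<forall>k\<ge>M. \<forall>F. finite F \<longrightarrow> (\<Sum>n\<in>F. (cmod (coef (X k) n - L n))\<^sup>2) \<le> (e / 2)\<^sup>2"
      using *[of "e / 2"] by auto
    have "dist (X k) (Ell2 L) \<le> e / 2" if "k \<ge> M" for k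
      unfolding dist_norm by (rule norm_ell2_leI) (use M that \<open>e > 0\<close> \<open>coef (Ell2 L) = L\<close> in auto)
    then show "\<exists>M. \<forall>k\<ge>M. dist (X k) (Ell2 L) < e"
      using \<open>e > 0\<close> by (intro exI[of _ M]) force
  qed
  then show "convergent X" by (auto simp: convergent_def)
qed

section \<open>Algebra and continuity of the complex inner product\<close>

lemma cinner_commute: "cinner a b = cnj (cinner b a)"
  unfolding cinner_def infsum_cnj[symmetric] by (simp add: mult.commute)

lemma cinner_add_left: "cinner (a + b) c = cinner a c + cinner b c"
  unfolding cinner_def
  by (subst infsum_add[symmetric]) (simp_all add: cinner_summable algebra_simps)

lemma cinner_cmul_left: "cinner (cmul c a) b = c * cinner a b"
  unfolding cinner_def by (subst infsum_cmult_right'[symmetric]) (simp add: algebra_simps)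

lemma cinner_uminus_left: "cinner (- a) b = - cinner a b"
  unfolding cinner_def by (simp add: infsum_uminus)

lemma cinner_diff_left: "cinner (a - b) c = cinner a c - cinner b c"
  using cinner_add_left[of a "- b" c] by (simp add: cinner_uminus_left)

lemma cinner_cmul_right: "cinner a (cmul c b) = cnj c * cinner a b"
  by (subst cinner_commute, subst cinner_cmul_left) (simp add: cinner_commute[of b a])

lemma cinner_diff_right: "cinner a (b - c) = cinner a b - cinner a c"
  by (subst cinner_commute, subst cinner_diff_left) (simp add: cinner_commute[of _ a])

lemma cmul_of_real: "cmul (of_real r) a = r *\<^sub>R a"
  by (rule ell2_eqI) simp

lemma Re_cinner: "Re (cinner a b) = inner a b"
  by (simp add: inner_ell2_def)

text \<open>Moving \<open>cmul \<i>\<close> out of the second slot multiplies by -i, which turns the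
  imaginary part into a real part. Continuity and isometry statements for \<open>cinner\<close> thus
  reduce to the real inner product.\<close>

lemma cinner_eq_inner: "cinner a b = Complex (inner a b) (inner a (cmul \<i> b))"
  unfolding Re_cinner[symmetric] by (simp add: complex_eq_iff cinner_cmul_right)

lemma norm_cmul: "norm (cmul c a) = cmod c * norm a"
proof -
  have "(norm (cmul c a))\<^sup>2 = (cmod c * norm a)\<^sup>2"
    by (simp add: norm_ell2_sq norm_mult power_mult_distrib infsum_cmult_right')
  then show ?thesis by (rule power2_eq_imp_eq) simp_all
qed

lemma tendsto_cinner_left:
  assumes "(f \<longlongrightarrow> a) F"
  shows "((\<lambda>x. cinner (f x) b) \<longlongrightarrow> cinner a b) F"
  unfolding cinner_eq_inner by (intro tendsto_Complex tendsto_inner assms tendsto_const)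

text \<open>Truncation to a finite set that carries the squared norm up to
  \<open>(e / 2)\<^sup>2\<close> leaves an error whose squared norm is the missing tail. In terms of
  functions this is density of the polynomials.\<close>

lemma finite_support_dense:
  fixes a :: "'i ell2"
  assumes "e > 0"
  shows "\<exists>F b. finite F \<and> (\<forall>n. n \<notin> F \<longrightarrow> coef b n = 0) \<and> norm (a - b) < e"
proof -
  obtain F where F: "finite F" "dist (\<Sum>n\<in>F. (cmod (coef a n))\<^sup>2) ((norm a)\<^sup>2) \<le> (e / 2)\<^sup>2"
    using infsum_finite_approximation[OF coef_summable[of a], of "(e / 2)\<^sup>2"] assms
    by (auto simp: norm_ell2_sq)
  define b where "b = Ell2 (\<lambda>n. if n \<in> F then coef a n else 0)"
  have "(\<lambda>n. (cmod (if n \<in> F then coef a n else 0))\<^sup>2) summable_on UNIV"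
    by (rule finite_nonzero_values_imp_summable_on) (rule finite_subset[OF _ F(1)], auto)
  then have b: "coef b n = (if n \<in> F then coef a n else 0)" for n
    by (simp add: b_def coef_Ell2)
  have "norm (a - b) \<le> e / 2"
  proof (rule norm_ell2_leI)
    fix G :: "'i set" assume G: "finite G"
    have "(\<Sum>n\<in>F. (cmod (coef a n))\<^sup>2) + (\<Sum>n\<in>G - F. (cmod (coef a n))\<^sup>2) \<le> (norm a)\<^sup>2"
      using sum_coef_le_norm[of "F \<union> (G - F)" a] F(1) G
        sum.union_disjoint[of F "G - F" "\<lambda>n. (cmod (coef a n))\<^sup>2"] by auto
    moreover have "(\<Sum>n\<in>G. (cmod (coef (a - b) n))\<^sup>2) = (\<Sum>n\<in>G - F. (cmod (coef a n))\<^sup>2)"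
      by (rule sum.mono_neutral_cong_right) (auto simp: b G)
    ultimately show "(\<Sum>n\<in>G. (cmod (coef (a - b) n))\<^sup>2) \<le> (e / 2)\<^sup>2"
      using F(2) by (simp add: dist_real_def)
  qed (use assms in simp)
  then show ?thesis using F(1) b assms by (intro exI[of _ F] exI[of _ b]) auto
qed

subsection \<open>Riesz representation\<close>

text \<open>The representing vector minimises \<open>\<parallel>v\<parallel>\<^sup>2 - 2 T v\<close>; the parallelogram law makes every minimising
  sequence Cauchy.\<close>

lemma riesz_representation_on_subspace:
  fixes V :: "'a::{real_inner, complete_space} set" and T :: "'a \<Rightarrow> real"
  assumes V: "subspace V" "closed V"
    and add: "\<And>u v. u \<in> V \<Longrightarrow> v \<in> V \<Longrightarrow> T (u + v) = T u + T v"
    and scale: "\<And>c u. u \<in> V \<Longrightarrow> T (c *\<^sub>R u) = c * T u"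
    and bound: "\<And>u. u \<in> V \<Longrightarrow> \<bar>T u\<bar> \<le> C * norm u"
  shows "\<exists>v\<in>V. \<forall>u\<in>V. T u = inner u v"
proof -
  define Q where "Q v = (norm v)\<^sup>2 - 2 * T v" for v
  \<comment> \<open>The bound on T gives Q v at least
    \<open>(norm v)\<^sup>2 - 2 * C * norm v\<close>; completing the square produces the
    constant.\<close>
  have Q_ge: "- C\<^sup>2 \<le> Q v" if "v \<in> V" for v
  proof -
    have "0 \<le> (norm v - C)\<^sup>2" by simp
    then show ?thesis using bound[OF that] unfolding Q_def power2_diff by (simp add: algebra_simps)
  qed
  define m where "m = (INF v\<in>V. Q v)"
  have bdd: "bdd_below (Q ` V)" by (rule bdd_belowI2, rule Q_ge)
  have ne: "V \<noteq> {}" using subspace_0[OF V(1)] by auto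
  have m_le: "m \<le> Q v" if "v \<in> V" for v unfolding m_def using bdd that by (rule cINF_lower)
  have "\<exists>v\<in>V. Q v < m + 1 / real (Suc k)" for k
  proof -
    have "Inf (Q ` V) < m + 1 / real (Suc k)" by (simp add: m_def)
    then show ?thesis using cInf_less_iff[OF _ bdd] ne by auto
  qed
  then obtain x where xV: "\<And>k. x k \<in> V" and x: "\<And>k. Q (x k) < m + 1 / real (Suc k)" by metis
  define \<delta> where "\<delta> k = 1 / real (Suc k)" for k
  have x\<delta>: "Q (x k) < m + \<delta> k" for k using x by (simp add: \<delta>_def)
  \<comment> \<open>The midpoint of u and v lies in V, so Q is at least m there; the parallelogram
    law rewrites this as a bound on the distance of u and v by their excesses over m.\<close>
  have gap: "(norm (u - v))\<^sup>2 \<le> 2 * (Q u - m) + 2 * (Q v - m)" if u: "u \<in> V" and v: "v \<in> V" for u v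
  proof -
    have mid: "(1 / 2) *\<^sub>R (u + v) \<in> V"
      by (intro subspace_mul subspace_add V u v)
    have "4 * m \<le> 4 * Q ((1 / 2) *\<^sub>R (u + v))" using m_le[OF mid] by simp
    also have "\<dots> = (norm (u + v))\<^sup>2 - 4 * (T u + T v)"
    proof -
      have "(norm ((1 / 2) *\<^sub>R (u + v)))\<^sup>2 = (norm (u + v))\<^sup>2 / 4"
        by (subst norm_scaleR) (simp add: power_divide)
      moreover have "T ((1 / 2) *\<^sub>R (u + v)) = (T u + T v) / 2"
        using scale[OF subspace_add[OF V(1) u v], of "1 / 2"] add[OF u v] by simp
      ultimately show ?thesis unfolding Q_def by simp
    qed
    also have "\<dots> = 2 * Q u + 2 * Q v - (norm (u - v))\<^sup>2"
      unfolding Q_def power2_norm_eq_inner by (simp add: algebra_simps inner_commute)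
    finally show ?thesis by simp
  qed
  have "Cauchy x"
  proof (rule metric_CauchyI)
    fix e :: real assume e: "e > 0"
    \<comment> \<open>The quarter is chosen because \<open>gap\<close> bounds the squared distance
      by twice the sum of two excesses, each below \<open>\<delta> M\<close>.\<close>
    obtain M where "1 / real (Suc M) < e\<^sup>2 / 4"
      using nat_approx_posE[of "e\<^sup>2 / 4"] e by auto
    then have M: "\<delta> M < e\<^sup>2 / 4" by (simp add: \<delta>_def)
    have "dist (x k) (x l) < e" if "k \<ge> M" "l \<ge> M" for k l
    proof -
      have "\<delta> k \<le> \<delta> M" "\<delta> l \<le> \<delta> M"
        unfolding \<delta>_def using that by (auto intro!: divide_left_mono)
      moreover have "n < E" if "n \<le> 2 * (p - m) + 2 * (q - m)" "p < m + a" "q < m + b" "a \<le> c" "b \<le> c" "c < E / 4"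
        for n p q a b c E :: real using that by (simp add: field_simps)
      ultimately have "(norm (x k - x l))\<^sup>2 < e\<^sup>2"
        using gap[OF xV xV, of k l] x\<delta>[of k] x\<delta>[of l] M by blast
      then show ?thesis using e by (simp add: dist_norm power2_less_imp_less)
    qed
    then show "\<exists>M. \<forall>k\<ge>M. \<forall>l\<ge>M. dist (x k) (x l) < e" by blast
  qed
  then obtain v where v: "x \<longlonglongrightarrow> v" using Cauchy_convergent convergent_def by blast
  have vV: "v \<in> V" using closed_sequentially[OF V(2) xV v] .
  have Tlim: "(\<lambda>k. T (x k)) \<longlonglongrightarrow> T v"
  proof -
    have "(\<lambda>k. T (x k) - T v) \<longlonglongrightarrow> 0"
    proof (rule Lim_null_comparison)
      have eq: "T (x k) - T v = T (x k - v)" for k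
        using add[of "x k - v" v] xV vV V(1) by (simp add: subspace_diff)
      show "\<forall>\<^sub>F k in sequentially. norm (T (x k) - T v) \<le> C * norm (x k - v)"
        unfolding eq using bound xV vV V(1) by (auto simp: subspace_diff)
      have "(\<lambda>k. norm (x k - v)) \<longlonglongrightarrow> 0" using v by (simp add: LIM_zero_iff tendsto_norm_zero)
      then show "(\<lambda>k. C * norm (x k - v)) \<longlonglongrightarrow> 0" by (rule tendsto_mult_right_zero)
    qed
    then show ?thesis by (simp add: LIM_zero_iff)
  qed
  have Qlim: "(\<lambda>k. Q (x k)) \<longlonglongrightarrow> Q v"
    unfolding Q_def by (intro tendsto_intros v Tlim)
  have "Q v \<le> m"
  proof (rule LIMSEQ_le[OF Qlim])
    show "(\<lambda>k. m + 1 / real (Suc k)) \<longlonglongrightarrow> m"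
      using tendsto_add[OF tendsto_const LIMSEQ_Suc[OF lim_1_over_n], of m] by simp
    show "\<exists>N. \<forall>k\<ge>N. Q (x k) \<le> m + 1 / real (Suc k)" using x less_imp_le by blast
  qed
  have "T u = inner u v" if u: "u \<in> V" for u
  proof -
    define d where "d = inner u v - T u"
    have quad: "0 \<le> t\<^sup>2 * (norm u)\<^sup>2 + 2 * t * d" for t
    proof -
      have tu: "t *\<^sub>R u \<in> V" by (intro subspace_mul V u)
      have "Q v \<le> Q (v + t *\<^sub>R u)"
        using \<open>Q v \<le> m\<close> m_le[of "v + t *\<^sub>R u"] subspace_add[OF V(1) vV tu] by simp
      also have "\<dots> = Q v + t\<^sup>2 * (norm u)\<^sup>2 + 2 * t * d"
        unfolding Q_def d_def add[OF vV tu] scale[OF u] power2_norm_eq_inner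
        by (simp add: inner_add_left inner_add_right inner_commute algebra_simps power2_eq_square)
      finally show ?thesis by simp
    qed
    \<comment> \<open>The quadratic in t is tested at t = - s d. This s makes its second-order term
      at most half the size of the linear one, which forces d = 0; the added 1 covers u = 0.\<close>
    define s where "s = 1 / ((norm u)\<^sup>2 + 1)"
    have pos: "(norm u)\<^sup>2 + 1 > 0" by (simp add: add_nonneg_pos)
    then have s: "s > 0" "s * (norm u)\<^sup>2 \<le> 1" by (simp_all add: s_def)
    have "0 \<le> s * d\<^sup>2 * (s * (norm u)\<^sup>2) - 2 * s * d\<^sup>2"
      using quad[of "- (s * d)"] by (simp add: power2_eq_square algebra_simps)
    also have "\<dots> \<le> s * d\<^sup>2 * 1 - 2 * s * d\<^sup>2"
      using s by (intro diff_right_mono mult_left_mono) auto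
    finally have "s * d\<^sup>2 \<le> 0" by simp
    then have "d = 0" using s by (simp add: mult_le_0_iff)
    then show ?thesis by (simp add: d_def)
  qed
  then show ?thesis using vV by blast
qed

text \<open>A complex-linear functional is determined by its real part, as its imaginary part at u
  is minus the real part at i u. Closure of V under complex multiples makes the test vector i u
  available.\<close>

lemma complex_riesz_on_subspace:
  fixes V :: "'i ell2 set" and T :: "'i ell2 \<Rightarrow> complex"
  assumes V: "subspace V" "closed V" "\<And>c u. u \<in> V \<Longrightarrow> cmul c u \<in> V"
    and add: "\<And>u v. u \<in> V \<Longrightarrow> v \<in> V \<Longrightarrow> T (u + v) = T u + T v"
    and scale: "\<And>c u. u \<in> V \<Longrightarrow> T (cmul c u) = c * T u"
    and bound: "\<And>u. u \<in> V \<Longrightarrow> cmod (T u) \<le> C * norm u"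
  shows "\<exists>v\<in>V. \<forall>u\<in>V. T u = cinner u v"
proof -
  have "\<exists>v\<in>V. \<forall>u\<in>V. Re (T u) = inner u v"
  proof (rule riesz_representation_on_subspace[OF V(1,2)])
    show "Re (T (u + v)) = Re (T u) + Re (T v)" if "u \<in> V" "v \<in> V" for u v
      using add[OF that] by simp
    show "Re (T (c *\<^sub>R u)) = c * Re (T u)" if "u \<in> V" for c u
      using scale[OF that, of "of_real c"] by (simp add: cmul_of_real)
    show "\<bar>Re (T u)\<bar> \<le> C * norm u" if "u \<in> V" for u
      using bound[OF that] abs_Re_le_cmod[of "T u"] by linarith
  qed
  then obtain v where v: "v \<in> V" "\<And>u. u \<in> V \<Longrightarrow> Re (T u) = inner u v" by blast
  have "T u = cinner u v" if u: "u \<in> V" for u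
  proof -
    have "Re (T (cmul \<i> u)) = Re (cinner (cmul \<i> u) v)"
      using v(2)[OF V(3)[OF u]] by (simp add: Re_cinner)
    then show ?thesis using v(2)[OF u] by (simp add: scale u cinner_cmul_left complex_eq_iff Re_cinner)
  qed
  then show ?thesis using v(1) by blast
qed

subsection \<open>Double power series on the bidisk\<close>

lemma has_sum_geometric:
  fixes x :: "'a::{real_normed_field, banach}"
  assumes "norm x < 1"
  shows "((\<lambda>k. x ^ k) has_sum 1 / (1 - x)) UNIV"
  by (rule norm_summable_imp_has_sum[OF _ geometric_sums])
    (use assms in \<open>simp_all add: norm_power summable_geometric\<close>)

lemma summable_on_geometric_prod:
  fixes x y :: real
  assumes "0 \<le> x" "x < 1" "0 \<le> y" "y < 1"
  shows "(\<lambda>(k, l). x ^ k * y ^ l) summable_on UNIV"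
proof -
  have "(\<lambda>(k, l). x ^ k * y ^ l) summable_on Sigma UNIV (\<lambda>_. UNIV)"
  proof (rule summable_on_SigmaI)
    show "((\<lambda>l. case (k, l) of (k, l) \<Rightarrow> x ^ k * y ^ l) has_sum x ^ k * (1 / (1 - y))) UNIV" for k
      using has_sum_cmult_right[OF has_sum_geometric[of y], of "x ^ k"] assms by simp
    show "(\<lambda>k. x ^ k * (1 / (1 - y))) summable_on UNIV"
      using has_sum_geometric[of x] assms by (intro summable_on_cmult_left) (auto simp: summable_on_def)
  qed (use assms in auto)
  then show ?thesis by simp
qed

lemma has_sum_geometric_prod:
  fixes x y :: complex
  assumes "cmod x < 1" "cmod y < 1"
  shows "((\<lambda>(k, l). x ^ k * y ^ l) has_sum 1 / ((1 - x) * (1 - y))) UNIV"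
proof -
  have "((\<lambda>(k, l). x ^ k * y ^ l) has_sum 1 / ((1 - x) * (1 - y))) (Sigma UNIV (\<lambda>_. UNIV))"
  proof (rule has_sum_SigmaI)
    show "((\<lambda>l. case (k, l) of (k, l) \<Rightarrow> x ^ k * y ^ l) has_sum x ^ k * (1 / (1 - y))) UNIV" for k
      using has_sum_cmult_right[OF has_sum_geometric[of y], of "x ^ k"] assms by simp
    show "((\<lambda>k. x ^ k * (1 / (1 - y))) has_sum 1 / ((1 - x) * (1 - y))) UNIV"
      using has_sum_cmult_left[OF has_sum_geometric[of x], of "1 / (1 - y)"] assms by simp
    show "(\<lambda>(k, l). x ^ k * y ^ l) summable_on Sigma UNIV (\<lambda>_. UNIV)"
      using summable_on_geometric_prod[of "cmod x" "cmod y"] assms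
      by - (rule abs_summable_summable, simp add: case_prod_unfold norm_mult norm_power)
  qed
  then show ?thesis by simp
qed

section \<open>Coefficient sequences as functions on the bidisk\<close>

lemma in_bidisk_iff: "z \<in> bidisk \<longleftrightarrow> cmod (fst z) < 1 \<and> cmod (snd z) < 1"
  by (auto simp: bidisk_def mem_Times_iff)

text \<open>Set to zero off the bidisk, so that \<open>eval\<close> below is linear as a map into total functions.\<close>

definition kern :: "complex \<times> complex \<Rightarrow> (nat \<times> nat) ell2"
  where "kern z =
    (if z \<in> bidisk then Ell2 (\<lambda>(k, l). cnj (fst z) ^ k * cnj (snd z) ^ l) else 0)"

text \<open>Point evaluation is taken as the inner product with the Szego kernel, so linearity and
  continuity in the coefficients are inherited from \<open>cinner\<close>; that it sums the power
  series is \<open>has_power_series_eval\<close>.\<close>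

definition eval :: "(nat \<times> nat) ell2 \<Rightarrow> complex \<times> complex \<Rightarrow> complex"
  where "eval a z = cinner a (kern z)"

lemma coef_kern:
  assumes "z \<in> bidisk"
  shows "coef (kern z) (k, l) = cnj (fst z) ^ k * cnj (snd z) ^ l"
proof -
  have "(\<lambda>(k, l). ((cmod (fst z))\<^sup>2) ^ k * ((cmod (snd z))\<^sup>2) ^ l) summable_on UNIV"
    using assms by (intro summable_on_geometric_prod) (auto simp: in_bidisk_iff abs_square_less_1)
  moreover have "(cmod (case n of (k, l) \<Rightarrow> cnj (fst z) ^ k * cnj (snd z) ^ l))\<^sup>2 =
      (case n of (k, l) \<Rightarrow> ((cmod (fst z))\<^sup>2) ^ k * ((cmod (snd z))\<^sup>2) ^ l)" for n
    by (cases n) (simp add: norm_mult norm_power power_mult_distrib power_mult[symmetric] mult.commute)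
  ultimately show ?thesis
    unfolding kern_def using assms by (simp add: coef_Ell2)
qed

lemma has_power_series_eval: "has_power_series (eval a) (coef a)"
  unfolding has_power_series_def
proof
  fix z assume z: "z \<in> bidisk"
  have "((\<lambda>n. coef a n * cnj (coef (kern z) n)) has_sum eval a z) UNIV"
    unfolding eval_def cinner_def by (rule has_sum_infsum[OF cinner_summable])
  moreover have "coef a n * cnj (coef (kern z) n) = (case n of (k, l) \<Rightarrow> coef a (k, l) * fst z ^ k * snd z ^ l)" for n
    by (cases n) (simp add: coef_kern[OF z] mult.assoc)
  ultimately show "((\<lambda>(k, l). coef a (k, l) * fst z ^ k * snd z ^ l) has_sum eval a z) UNIV"
    by simp
qed

text \<open>A power series with a nonzero coefficient of positive index and value 0 at the origin is
  zero-free on some punctured disc, which the zero function is not. The constant coefficient is read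
  off at the origin.\<close>

lemma power_series_coeffs_zero:
  fixes a :: "nat \<Rightarrow> complex"
  assumes "\<And>z. cmod z < 1 \<Longrightarrow> (\<lambda>n. a n * z ^ n) sums 0"
  shows "a n = 0"
proof (rule ccontr)
  assume nz: "a n \<noteq> 0"
  show False
  proof (cases "n = 0")
    case True
    then show False using assms[of 0] nz powser_sums_zero_iff[of a 0] by simp
  next
    case False
    show False
    proof (rule powser_0_nonzero[of 1 0 a "\<lambda>_. 0" n])
      fix s :: real assume "0 < s" "\<And>z::complex. z \<in> cball 0 s - {0} \<Longrightarrow> (0::complex) \<noteq> 0"
      from this(2)[of "of_real s"] this(1) show False by simp
    qed (use assms nz False in auto)
  qed
qed

text \<open>With w fixed, the difference of the two series is a one-variable series in z whose
  coefficients are series in w; the one-variable statement is applied first in z and then in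
  w.\<close>

lemma has_power_series_unique:
  assumes "has_power_series f a" "has_power_series f b"
  shows "a = b"
proof -
  define d where "d n = a n - b n" for n
  have d: "((\<lambda>(k, l). d (k, l) * z ^ k * w ^ l) has_sum 0) UNIV" if "cmod z < 1" "cmod w < 1" for z w
  proof -
    have "(z, w) \<in> bidisk" using that by (simp add: in_bidisk_iff)
    then have "((\<lambda>(k, l). a (k, l) * z ^ k * w ^ l) has_sum f (z, w)) UNIV"
        "((\<lambda>(k, l). b (k, l) * z ^ k * w ^ l) has_sum f (z, w)) UNIV"
      using assms by (auto simp: has_power_series_def)
    then have "((\<lambda>n. (\<lambda>(k, l). a (k, l) * z ^ k * w ^ l) n + - (\<lambda>(k, l). b (k, l) * z ^ k * w ^ l) n) has_sum
        (f (z, w) + - f (z, w))) UNIV"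
      by (intro has_sum_add has_sum_uminus[THEN iffD2]) simp_all
    then show ?thesis by (simp add: d_def case_prod_unfold algebra_simps)
  qed
  \<comment> \<open>The point 1/2 stands for any nonzero z in the disc: row k is summable with the
    factor \<open>(1 / 2) ^ k\<close>, which is then divided out.\<close>
  have inner_summable: "(\<lambda>l. d (k, l) * w ^ l) summable_on UNIV" if w: "cmod w < 1" for k w
  proof -
    have "(\<lambda>(k, l). d (k, l) * (1 / 2) ^ k * w ^ l) summable_on Sigma UNIV (\<lambda>_. UNIV)"
      using d[of "1 / 2" w] w by (auto simp: summable_on_def)
    then have "(\<lambda>l. d (k, l) * (1 / 2) ^ k * w ^ l) summable_on UNIV"
      by (rule summable_on_SigmaD1) simp
    then have "(\<lambda>l. 2 ^ k * (d (k, l) * (1 / 2) ^ k * w ^ l)) summable_on UNIV"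
      by (rule summable_on_cmult_right)
    then show ?thesis by (simp add: field_simps)
  qed
  define g where "g w k = (\<Sum>\<^sub>\<infinity>l. d (k, l) * w ^ l)" for w k
  have g: "((\<lambda>l. d (k, l) * w ^ l) has_sum g w k) UNIV" if "cmod w < 1" for w k
    unfolding g_def by (rule has_sum_infsum[OF inner_summable[OF that]])
  have "g w k = 0" if w: "cmod w < 1" for w k
  proof (rule power_series_coeffs_zero)
    fix z :: complex assume z: "cmod z < 1"
    have "((\<lambda>k. z ^ k * g w k) has_sum 0) UNIV"
    proof (rule has_sum_SigmaD)
      show "((\<lambda>(k, l). d (k, l) * z ^ k * w ^ l) has_sum 0) (Sigma UNIV (\<lambda>_. UNIV))"
        using d[OF z w] by simp
      show "((\<lambda>l. case (k, l) of (k, l) \<Rightarrow> d (k, l) * z ^ k * w ^ l) has_sum z ^ k * g w k) UNIV" for k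
        using has_sum_cmult_right[OF g[OF w, of k], of "z ^ k"] by (simp add: mult_ac)
    qed
    then show "(\<lambda>k. g w k * z ^ k) sums 0" by (simp add: has_sum_imp_sums mult.commute)
  qed
  then have "d (k, l) = 0" for k l
    using has_sum_imp_sums[OF g] by (intro power_series_coeffs_zero[of "\<lambda>l. d (k, l)"]) simp
  then show ?thesis by (auto simp: d_def fun_eq_iff)
qed

lemma power_series_coeff_eq: "has_power_series f a \<Longrightarrow> power_series_coeff f = a"
  unfolding power_series_coeff_def by (rule the_equality) (auto intro: has_power_series_unique)

lemma has_power_series_cong:
  "(\<And>z. z \<in> bidisk \<Longrightarrow> f z = g z) \<Longrightarrow> has_power_series f a \<longleftrightarrow> has_power_series g a"
  by (simp add: has_power_series_def)

section \<open>Translation between Hardy space functions and coefficient vectors\<close>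

definition hardy_coef :: "(complex \<times> complex \<Rightarrow> complex) \<Rightarrow> (nat \<times> nat) ell2"
  where "hardy_coef f = Ell2 (power_series_coeff f)"

lemma coef_hardy_coef:
  assumes "f \<in> hardy_space"
  shows "coef (hardy_coef f) = power_series_coeff f"
  using assms by (auto simp: hardy_space_def hardy_coef_def power_series_coeff_eq coef_Ell2)

lemma eval_hardy_coef:
  assumes "f \<in> hardy_space" "z \<in> bidisk"
  shows "eval (hardy_coef f) z = f z"
proof -
  obtain a where a: "has_power_series f a" using assms(1) by (auto simp: hardy_space_def)
  have "coef (hardy_coef f) = a"
    using coef_hardy_coef[OF assms(1)] power_series_coeff_eq[OF a] by simp
  then have "has_power_series (eval (hardy_coef f)) a"
    using has_power_series_eval[of "hardy_coef f"] by simp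
  then show ?thesis using a assms(2) unfolding has_power_series_def by (blast intro: has_sum_unique)
qed

text \<open>Agreement on the bidisk is enough, so this is the way to recognise Hardy space
  membership and to compute coefficients of functions given by a formula.\<close>

lemma hardy_space_evalI:
  assumes "\<And>z. z \<in> bidisk \<Longrightarrow> f z = eval a z"
  shows "f \<in> hardy_space" "hardy_coef f = a"
proof -
  have "has_power_series f (coef a)"
    using has_power_series_cong[of f "eval a"] assms has_power_series_eval by blast
  then show "f \<in> hardy_space" "hardy_coef f = a"
    by (auto simp: hardy_space_def hardy_coef_def power_series_coeff_eq coef_inverse
        intro: coef_summable exI[of _ "coef a"])
qed

lemma eval_in_hardy_space [simp]: "eval a \<in> hardy_space" "hardy_coef (eval a) = a"
  using hardy_space_evalI[of "eval a" a] by simp_all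

lemma hardy_inner_eq:
  "f \<in> hardy_space \<Longrightarrow> g \<in> hardy_space \<Longrightarrow> hardy_inner f g = cinner (hardy_coef f) (hardy_coef g)"
  by (simp add: hardy_inner_def cinner_def coef_hardy_coef)

lemma hardy_norm_eq: "f \<in> hardy_space \<Longrightarrow> hardy_norm f = norm (hardy_coef f)"
  unfolding hardy_norm_def by (simp flip: coef_hardy_coef norm_ell2_sq)

lemma eval_simps:
  "eval (a + b) z = eval a z + eval b z" "eval (a - b) z = eval a z - eval b z"
  "eval (cmul c a) z = c * eval a z"
  by (simp_all add: eval_def cinner_add_left cinner_diff_left cinner_cmul_left)

lemma tendsto_eval: "(f \<longlongrightarrow> a) F \<Longrightarrow> ((\<lambda>x. eval (f x) z) \<longlongrightarrow> eval a z) F"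
  unfolding eval_def by (rule tendsto_cinner_left)

lemma eval_kern:
  assumes "z \<in> bidisk" "w \<in> bidisk"
  shows "eval (kern w) z = szego_kernel w z"
proof -
  have "cmod (u * cnj v) < 1" if "cmod u < 1" "cmod v < 1" for u v
    using that mult_left_le[of "cmod v" "cmod u"] by (simp add: norm_mult mult.commute)
  then have *: "cmod (fst z * cnj (fst w)) < 1" "cmod (snd z * cnj (snd w)) < 1"
    using assms by (simp_all add: in_bidisk_iff)
  have "((\<lambda>(k, l). coef (kern w) (k, l) * fst z ^ k * snd z ^ l) has_sum eval (kern w) z) UNIV"
    using has_power_series_eval assms(1) unfolding has_power_series_def by blast
  moreover have "((\<lambda>(k, l). coef (kern w) (k, l) * fst z ^ k * snd z ^ l) has_sum szego_kernel w z) UNIV"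
    using has_sum_geometric_prod[OF *] assms(2)
    by (simp add: coef_kern szego_kernel_def power_mult_distrib mult_ac)
  ultimately show ?thesis by (rule has_sum_unique)
qed

subsection \<open>Bounded holomorphic functions on the bidisk\<close>

lemma taylor_coeff_bound:
  assumes "f holomorphic_on ball 0 1" "\<And>z. cmod z < 1 \<Longrightarrow> cmod (f z) \<le> B" "0 < r" "r < 1"
  shows "cmod ((deriv ^^ k) f 0 / fact k) \<le> B / r ^ k"
proof -
  have "cmod ((deriv ^^ k) f 0) \<le> fact k * B / r ^ k"
  proof (rule Cauchy_inequality)
    show "f holomorphic_on ball 0 r"
      by (rule holomorphic_on_subset[OF assms(1)]) (use assms in auto)
    show "continuous_on (cball 0 r) f"
      by (rule continuous_on_subset[OF holomorphic_on_imp_continuous_on[OF assms(1)]]) (use assms in auto)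
  qed (use assms in auto)
  then show ?thesis by (simp add: norm_divide field_simps)
qed

text \<open>The \<open>k\<close>-th Taylor coefficient in the first variable is the locally uniform limit, as \<open>z\<close> tends to
  \<open>0\<close>, of \<open>z\<^sup>-\<^sup>k\<close> times the Taylor remainder of order \<open>k\<close>; so holomorphy in the second variable passes from
  the lower coefficients to the \<open>k\<close>-th.\<close>

lemma holomorphic_partial_taylor_coeff:
  fixes F :: "complex \<Rightarrow> complex \<Rightarrow> complex"
  assumes hol1: "\<And>w. cmod w < 1 \<Longrightarrow> (\<lambda>z. F z w) holomorphic_on ball 0 1"
    and hol2: "\<And>z. cmod z < 1 \<Longrightarrow> F z holomorphic_on ball 0 1"
    and bdd: "\<And>z w. cmod z < 1 \<Longrightarrow> cmod w < 1 \<Longrightarrow> cmod (F z w) \<le> B"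
  shows "(\<lambda>w. (deriv ^^ k) (\<lambda>z. F z w) 0 / fact k) holomorphic_on ball 0 1"
proof (induction k rule: less_induct)
  case (less k)
  define c where "c j w = (deriv ^^ j) (\<lambda>z. F z w) 0 / fact j" for j w
  have B: "0 \<le> B" using order_trans[OF norm_ge_zero bdd[of 0 0]] by simp
  have c_le: "cmod (c j w) \<le> B * 2 ^ j" if "cmod w < 1" for j w
    using taylor_coeff_bound[OF hol1[OF that] bdd[OF _ that], of "1 / 2" j]
    by (simp add: c_def power_one_over field_simps)
  \<comment> \<open>The points tend to 0 without reaching it. The shift by 4 keeps their modulus at
    most 1/4: Cauchy estimates at radius 1/2 bound the coefficients by \<open>B * 2 ^ j\<close>, so
    the tail is dominated by a geometric series of ratio at most 1/2. Its sum contributes one factor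
    2 and its first term the other, whence the 4 in \<open>R\<close>.\<close>
  define x where "x n = complex_of_real (1 / real (n + 4))" for n
  have x: "x n \<noteq> 0" "cmod (x n) = 1 / real (n + 4)" "cmod (x n) \<le> 1 / 4" "cmod (x n) < 1" for n
    by (simp_all add: x_def norm_divide del: of_nat_add of_real_add)
  define R where "R n w = (F (x n) w - (\<Sum>j<k. c j w * x n ^ j)) / x n ^ k" for n w
  have R: "cmod (R n w - c k w) \<le> B * 2 ^ k * 4 * cmod (x n)" if w: "cmod w < 1" for n w
  proof -
    have sums: "(\<lambda>j. c j w * x n ^ j) sums F (x n) w"
      using holomorphic_power_series[OF hol1[OF w], of "x n"] x(4)[of n] by (simp add: c_def)
    have "(\<lambda>i. c (i + k) w * x n ^ (i + k)) sums (F (x n) w - (\<Sum>j<k. c j w * x n ^ j))"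
      using sums_split_initial_segment[OF sums, of k] .
    then have "(\<lambda>i. c (i + k) w * x n ^ (i + k) / x n ^ k) sums R n w"
      unfolding R_def by (rule sums_divide)
    then have "(\<lambda>i. c (i + k) w * x n ^ i) sums R n w"
      using x(1)[of n] by (simp add: power_add)
    then have tail: "(\<lambda>i. c (Suc i + k) w * x n ^ Suc i) sums (R n w - c k w)"
      by (subst sums_Suc_iff) simp
    have geo: "(\<lambda>i. B * 2 ^ k * (2 * cmod (x n)) * (2 * cmod (x n)) ^ i) sums
        (B * 2 ^ k * (2 * cmod (x n)) * (1 / (1 - 2 * cmod (x n))))"
      using x(3)[of n] by (intro sums_mult geometric_sums) simp
    have "cmod (R n w - c k w) \<le> B * 2 ^ k * (2 * cmod (x n)) * (1 / (1 - 2 * cmod (x n)))"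
      unfolding sums_unique[OF tail] sums_unique[OF geo]
    proof (rule norm_suminf_le)
      show "summable (\<lambda>i. B * 2 ^ k * (2 * cmod (x n)) * (2 * cmod (x n)) ^ i)"
        using geo by (rule sums_summable)
      fix i
      have "cmod (c (Suc i + k) w * x n ^ Suc i) \<le> B * 2 ^ (Suc i + k) * cmod (x n) ^ Suc i"
        unfolding norm_mult norm_power by (intro mult_right_mono c_le w) simp
      then show "cmod (c (Suc i + k) w * x n ^ Suc i) \<le> B * 2 ^ k * (2 * cmod (x n)) * (2 * cmod (x n)) ^ i"
        by (simp add: power_add power_mult_distrib mult_ac)
    qed
    also have "\<dots> \<le> B * 2 ^ k * (2 * cmod (x n)) * 2"
      using x(3)[of n] B by (intro mult_left_mono) (auto simp: field_simps)
    finally show ?thesis by (simp add: mult_ac)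
  qed
  have "c k holomorphic_on ball 0 1"
  proof (rule holomorphic_uniform_sequence)
    have "c j holomorphic_on ball 0 1" if "j < k" for j
      unfolding c_def by (rule less[OF that])
    then show "R n holomorphic_on ball 0 1" for n
      unfolding R_def by (intro holomorphic_intros hol2 x) (auto simp: x)
    fix y :: complex assume "y \<in> ball 0 1"
    then obtain d where d: "d > 0" "cball y d \<subseteq> ball 0 1"
      using open_contains_cball[of "ball 0 1"] by blast
    have "uniform_limit (cball y d) R (c k) sequentially"
    proof (rule uniform_limitI)
      fix e :: real assume e: "e > 0"
      have "(\<lambda>n. B * 2 ^ k * 4 * (1 / real (n + 4))) \<longlonglongrightarrow> B * 2 ^ k * 4 * 0"
        by (intro tendsto_intros LIMSEQ_ignore_initial_segment lim_1_over_n)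
      then have "\<forall>\<^sub>F n in sequentially. B * 2 ^ k * 4 * (1 / real (n + 4)) < e"
        using e by (intro order_tendstoD(2)) auto
      then show "\<forall>\<^sub>F n in sequentially. \<forall>w\<in>cball y d. dist (R n w) (c k w) < e"
      proof eventually_elim
        case (elim n)
        have "cmod (R n w - c k w) < e" if "w \<in> cball y d" for w
        proof -
          have "cmod w < 1" using d(2) that by auto
          then show ?thesis using R[of w n] elim unfolding x(2) by linarith
        qed
        then show ?case by (simp add: dist_norm)
      qed
    qed
    then show "\<exists>d>0. cball y d \<subseteq> ball 0 1 \<and> uniform_limit (cball y d) R (c k) sequentially"
      using d by blast
  qed simp
  then show ?case by (simp only: c_def[abs_def])
qed

text \<open>The function is expanded in z and each coefficient, holomorphic in w by the preceding
  lemma, is expanded in w. Iterated Cauchy estimates make the resulting double series absolutely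
  summable, so the iterated sum equals the unordered one.\<close>

lemma bounded_separately_holomorphic_power_series:
  fixes F :: "complex \<Rightarrow> complex \<Rightarrow> complex"
  assumes hol1: "\<And>w. cmod w < 1 \<Longrightarrow> (\<lambda>z. F z w) holomorphic_on ball 0 1"
    and hol2: "\<And>z. cmod z < 1 \<Longrightarrow> F z holomorphic_on ball 0 1"
    and bdd: "\<And>z w. cmod z < 1 \<Longrightarrow> cmod w < 1 \<Longrightarrow> cmod (F z w) \<le> B"
  shows "\<exists>a. has_power_series (\<lambda>z. F (fst z) (snd z)) a"
proof -
  define c where "c k w = (deriv ^^ k) (\<lambda>z. F z w) 0 / fact k" for k w
  define a where "a k l = (deriv ^^ l) (c k) 0 / fact l" for k l
  have c_hol: "c k holomorphic_on ball 0 1" for k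
    unfolding c_def by (rule holomorphic_partial_taylor_coeff[OF assms])
  have c_le: "cmod (c k w) \<le> B / r ^ k" if "cmod w < 1" "0 < r" "r < 1" for k w r
    unfolding c_def using taylor_coeff_bound[OF hol1[OF that(1)] bdd[OF _ that(1)] that(2,3)] .
  \<comment> \<open>The Cauchy bound for the coefficient function \<open>c k\<close> serves as the
    sup bound in a second Cauchy estimate, now in w.\<close>
  have a_le: "cmod (a k l) \<le> B / r ^ k / s ^ l" if "0 < r" "r < 1" "0 < s" "s < 1" for k l r s
    unfolding a_def using taylor_coeff_bound[OF c_hol c_le[OF _ that(1,2)] that(3,4)] .
  have "((\<lambda>(k, l). a k l * z ^ k * w ^ l) has_sum F z w) UNIV" if z: "cmod z < 1" and w: "cmod w < 1" for z w
  proof -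
    obtain r where r: "cmod z < r" "r < 1" using dense[OF z] by blast
    obtain s where s: "cmod w < s" "s < 1" using dense[OF w] by blast
    have pos: "0 < r" "0 < s" using r s norm_ge_zero le_less_trans by blast+
    have summ: "(\<lambda>(k, l). a k l * z ^ k * w ^ l) summable_on UNIV"
    proof (rule abs_summable_summable, rule summable_on_comparison_test)
      show "(\<lambda>n. B * (\<lambda>(k, l). (cmod z / r) ^ k * (cmod w / s) ^ l) n) summable_on UNIV"
        using r s pos by (intro summable_on_cmult_right summable_on_geometric_prod) auto
      show "cmod (case n of (k, l) \<Rightarrow> a k l * z ^ k * w ^ l)
          \<le> B * (\<lambda>(k, l). (cmod z / r) ^ k * (cmod w / s) ^ l) n" for n
      proof (cases n)
        case (Pair k l)
        have "cmod (a k l) * (cmod z ^ k * cmod w ^ l) \<le> B / r ^ k / s ^ l * (cmod z ^ k * cmod w ^ l)"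
          by (intro mult_right_mono a_le) (use r s pos in auto)
        then show ?thesis by (simp add: Pair norm_mult norm_power power_divide mult_ac)
      qed
    qed simp
    have row: "((\<lambda>l. a k l * z ^ k * w ^ l) has_sum c k w * z ^ k) UNIV" for k
    proof -
      have "(\<lambda>l. a k l * w ^ l) sums c k w"
        using holomorphic_power_series[OF c_hol, of w k] w by (simp add: a_def)
      then have "(\<lambda>l. a k l * w ^ l * z ^ k) sums (c k w * z ^ k)" by (rule sums_mult2)
      moreover have "(\<lambda>l. a k l * z ^ k * w ^ l) summable_on UNIV"
        by (rule summable_on_SigmaD1[where A = UNIV and B = "\<lambda>_. UNIV"]) (use summ in simp_all)
      from this have sum: "((\<lambda>l. a k l * z ^ k * w ^ l) has_sum (\<Sum>\<^sub>\<infinity>l. a k l * z ^ k * w ^ l)) UNIV"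
        by (rule has_sum_infsum)
      ultimately have "(\<Sum>\<^sub>\<infinity>l. a k l * z ^ k * w ^ l) = c k w * z ^ k"
        using sums_unique2[OF has_sum_imp_sums[OF sum]] by (simp add: mult_ac)
      with sum show ?thesis by simp
    qed
    have "((\<lambda>k. c k w * z ^ k) has_sum (\<Sum>\<^sub>\<infinity>(k, l). a k l * z ^ k * w ^ l)) UNIV"
    proof (rule has_sum_SigmaD)
      show "((\<lambda>(k, l). a k l * z ^ k * w ^ l) has_sum (\<Sum>\<^sub>\<infinity>(k, l). a k l * z ^ k * w ^ l))
          (Sigma UNIV (\<lambda>_. UNIV))"
        using has_sum_infsum[OF summ] by simp
    qed (use row in simp)
    moreover have "(\<lambda>k. c k w * z ^ k) sums F z w"
      using holomorphic_power_series[OF hol1[OF w], of z] z by (simp add: c_def)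
    ultimately have "(\<Sum>\<^sub>\<infinity>(k, l). a k l * z ^ k * w ^ l) = F z w"
      using has_sum_imp_sums sums_unique2 by blast
    then show ?thesis using has_sum_infsum[OF summ] by simp
  qed
  then have "has_power_series (\<lambda>z. F (fst z) (snd z)) (\<lambda>(k, l). a k l)"
    by (simp add: has_power_series_def in_bidisk_iff)
  then show ?thesis by blast
qed

lemma holomorphic2_imp_separately_holomorphic:
  assumes f: "holomorphic2_on f bidisk"
  shows "cmod w < 1 \<Longrightarrow> (\<lambda>z. f (z, w)) holomorphic_on ball 0 1"
    and "cmod z < 1 \<Longrightarrow> (\<lambda>w. f (z, w)) holomorphic_on ball 0 1"
proof -
  have D: "\<exists>a b. (f has_derivative (\<lambda>(u, v). a * u + b * v)) (at (z, w) within bidisk)"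
    if "cmod z < 1" "cmod w < 1" for z w
    using f that by (auto simp: holomorphic2_on_def in_bidisk_iff)
  show "(\<lambda>z. f (z, w)) holomorphic_on ball 0 1" if w: "cmod w < 1"
  proof (rule holomorphic_onI)
    fix z :: complex assume "z \<in> ball 0 1"
    then obtain a b where ab: "(f has_derivative (\<lambda>(u, v). a * u + b * v)) (at (z, w) within bidisk)"
      using D[of z w] w by auto
    have sub: "(\<lambda>z. (z, w)) ` ball 0 1 \<subseteq> bidisk" using w by (auto simp: in_bidisk_iff)
    have "((\<lambda>z. (z, w)) has_derivative (\<lambda>u. (u, 0))) (at z within ball 0 1)"
      by (auto intro!: derivative_eq_intros)
    from has_derivative_in_compose[OF this has_derivative_subset[OF ab sub]]
    have "((\<lambda>z. f (z, w)) has_derivative (\<lambda>u. a * u)) (at z within ball 0 1)" by simp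
    then show "(\<lambda>z. f (z, w)) field_differentiable at z within ball 0 1"
      by (auto simp: field_differentiable_def has_field_derivative_def)
  qed
  show "(\<lambda>w. f (z, w)) holomorphic_on ball 0 1" if z: "cmod z < 1"
  proof (rule holomorphic_onI)
    fix w :: complex assume "w \<in> ball 0 1"
    then obtain a b where ab: "(f has_derivative (\<lambda>(u, v). a * u + b * v)) (at (z, w) within bidisk)"
      using D[of z w] z by auto
    have sub: "(\<lambda>w. (z, w)) ` ball 0 1 \<subseteq> bidisk" using z by (auto simp: in_bidisk_iff)
    have "((\<lambda>w. (z, w)) has_derivative (\<lambda>v. (0, v))) (at w within ball 0 1)"
      by (auto intro!: derivative_eq_intros)
    from has_derivative_in_compose[OF this has_derivative_subset[OF ab sub]]
    have "((\<lambda>w. f (z, w)) has_derivative (\<lambda>v. b * v)) (at w within ball 0 1)" by simp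
    then show "(\<lambda>w. f (z, w)) field_differentiable at w within ball 0 1"
      by (auto simp: field_differentiable_def has_field_derivative_def)
  qed
qed

subsection \<open>Square means over the torus\<close>

text \<open>Angles parametrising the torus, with unnormalised Lebesgue measure of mass
  \<open>4 * pi\<^sup>2\<close>; this is the factor that accompanies every mean value below.\<close>

definition square :: "(real \<times> real) measure"
  where "square = restrict_space lborel (cbox (0, 0) (2 * pi, 2 * pi))"

definition dilate :: "real \<Rightarrow> real \<times> real \<Rightarrow> complex \<times> complex"
  where "dilate r p = (of_real r * cis (fst p), of_real r * cis (snd p))"

definition character :: "nat \<times> nat \<Rightarrow> real \<times> real \<Rightarrow> complex"
  where "character n p = cis (fst p) ^ fst n * cis (snd p) ^ snd n"

lemma finite_measure_square: "finite_measure square"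
  by (rule finite_measureI)
    (simp add: square_def space_restrict_space emeasure_restrict_space emeasure_lborel_cbox_eq)

interpretation square: finite_measure square by (rule finite_measure_square)

lemma measurable_square:
  fixes f :: "real \<times> real \<Rightarrow> 'a::topological_space"
  shows "f \<in> borel_measurable borel \<Longrightarrow> f \<in> borel_measurable square"
  unfolding square_def by (rule measurable_restrict_space1) simp

lemma cmod_character [simp]: "cmod (character n p) = 1"
  by (simp add: character_def norm_mult norm_power)

lemma continuous_character: "continuous_on S (character n)"
  unfolding character_def by (intro continuous_intros)

lemma borel_measurable_character [measurable]: "character n \<in> borel_measurable square"
  by (intro measurable_square borel_measurable_continuous_onI continuous_character)

lemma integral_square:
  fixes f :: "real \<times> real \<Rightarrow> complex"
  assumes "continuous_on UNIV f"
  shows "(\<integral>p. f p \<partial>square) = integral {0..2 * pi} (\<lambda>s. integral {0..2 * pi} (\<lambda>t. f (s, t)))"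
proof -
  let ?C = "cbox (0, 0) (2 * pi, 2 * pi) :: (real \<times> real) set"
  have cont: "continuous_on ?C f" using assms by (rule continuous_on_subset) simp
  have "(\<integral>p. f p \<partial>square) = (LINT p : ?C | lborel. f p)"
    by (simp add: square_def integral_restrict_space set_lebesgue_integral_def)
  also have "\<dots> = integral ?C f"
    by (rule set_borel_integral_eq_integral(2))
      (use borel_integrable_compact[OF compact_cbox cont] in \<open>simp add: set_integrable_def\<close>)
  also have "\<dots> = integral {0..2 * pi} (\<lambda>s. integral {0..2 * pi} (\<lambda>t. f (s, t)))"
    using integral_prod_continuous[OF cont] by (simp add: cbox_interval)
  finally show ?thesis .
qed

text \<open>For different exponents the integrand is \<open>cis (j * t)\<close> with a nonzero
  integer j, and its antiderivative takes equal values at both ends of the period.\<close>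

lemma integral_cis_power:
  "integral {0..2 * pi} (\<lambda>t. cis t ^ m * cnj (cis t ^ n)) = (if m = n then of_real (2 * pi) else 0)"
proof -
  define j where "j = real m - real n"
  have eq: "cis t ^ m * cnj (cis t ^ n) = cis (j * t)" for t
    unfolding complex_cnj_power cis_cnj Complex.DeMoivre cis_mult
    by (rule arg_cong[where f = cis]) (simp add: j_def algebra_simps)
  show ?thesis
  proof (cases "m = n")
    case True
    then show ?thesis unfolding eq by (simp add: j_def scaleR_conv_of_real)
  next
    case False
    then have j: "j \<noteq> 0" by (simp add: j_def)
    have "((\<lambda>t. cis (j * t)) has_integral (cis (j * (2 * pi)) / (\<i> * j) - cis (j * 0) / (\<i> * j))) {0..2 * pi}"
    proof (rule fundamental_theorem_of_calculus)
      fix t assume "t \<in> {0..2 * pi}"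
      show "((\<lambda>t. cis (j * t) / (\<i> * j)) has_vector_derivative cis (j * t)) (at t within {0..2 * pi})"
      proof -
        have "((\<lambda>z. exp (\<i> * of_real j * z) / (\<i> * of_real j)) has_field_derivative exp (\<i> * of_real j * of_real t))
            (at (of_real t))"
          using j by (auto intro!: derivative_eq_intros)
        from has_vector_derivative_real_field[OF this] show ?thesis
          by (simp add: cis_conv_exp mult.assoc)
      qed
    qed simp
    moreover have "cis (j * (2 * pi)) = 1"
    proof -
      have "j * (2 * pi) = 2 * pi * of_int (int m - int n)" by (simp add: j_def)
      then show ?thesis by (simp only: cis_multiple_2pi Ints_of_int)
    qed
    ultimately show ?thesis unfolding eq using False by (simp add: integral_unique)
  qed
qed

lemma character_orthogonal:
  "(\<integral>p. character n p * cnj (character m p) \<partial>square) = (if n = m then of_real (4 * pi\<^sup>2) else 0)"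
proof -
  have "(\<integral>p. character n p * cnj (character m p) \<partial>square) =
      integral {0..2 * pi} (\<lambda>s. integral {0..2 * pi} (\<lambda>t. character n (s, t) * cnj (character m (s, t))))"
    by (intro integral_square continuous_intros continuous_character)
  also have "\<dots> = integral {0..2 * pi} (\<lambda>s. (cis s ^ fst n * cnj (cis s ^ fst m)) *
      integral {0..2 * pi} (\<lambda>t. cis t ^ snd n * cnj (cis t ^ snd m)))"
    by (subst integral_mult_right[symmetric]) (simp add: character_def mult_ac)
  also have "\<dots> = integral {0..2 * pi} (\<lambda>s. cis s ^ fst n * cnj (cis s ^ fst m)) *
      integral {0..2 * pi} (\<lambda>t. cis t ^ snd n * cnj (cis t ^ snd m))"
    by (rule integral_mult_left)
  also have "\<dots> = (if n = m then of_real (4 * pi\<^sup>2) else 0)"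
    unfolding integral_cis_power by (auto simp: prod_eq_iff power2_eq_square)
  finally show ?thesis .
qed

lemma parseval_finite:
  assumes "finite F"
  shows "(\<integral>p. (cmod (\<Sum>n\<in>F. b n * character n p))\<^sup>2 \<partial>square) = 4 * pi\<^sup>2 * (\<Sum>n\<in>F. (cmod (b n))\<^sup>2)"
proof -
  have int: "integrable square (\<lambda>p. b n * cnj (b m) * (character n p * cnj (character m p)))" for n m
  proof (rule square.integrable_const_bound)
    show "AE p in square. norm (b n * cnj (b m) * (character n p * cnj (character m p))) \<le> cmod (b n * cnj (b m))"
      by (simp add: norm_mult)
    show "(\<lambda>p. b n * cnj (b m) * (character n p * cnj (character m p))) \<in> borel_measurable square"
      by (intro measurable_square borel_measurable_continuous_onI continuous_intros continuous_character)
  qed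
  have "complex_of_real (\<integral>p. (cmod (\<Sum>n\<in>F. b n * character n p))\<^sup>2 \<partial>square) =
      (\<integral>p. complex_of_real ((cmod (\<Sum>n\<in>F. b n * character n p))\<^sup>2) \<partial>square)"
    by (rule integral_complex_of_real[symmetric])
  also have "\<dots> = (\<integral>p. (\<Sum>n\<in>F. \<Sum>m\<in>F. b n * cnj (b m) * (character n p * cnj (character m p))) \<partial>square)"
    unfolding complex_norm_square cnj_sum sum_product by (simp add: mult_ac)
  also have "\<dots> = (\<Sum>n\<in>F. \<Sum>m\<in>F. b n * cnj (b m) * (\<integral>p. character n p * cnj (character m p) \<partial>square))"
    using int by (subst Bochner_Integration.integral_sum) (auto intro!: Bochner_Integration.integrable_sum sum.cong)
  also have "\<dots> = (\<Sum>n\<in>F. b n * cnj (b n) * of_real (4 * pi\<^sup>2))"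
    unfolding character_orthogonal using assms by (simp add: if_distrib cong: if_cong)
  also have "\<dots> = complex_of_real (4 * pi\<^sup>2 * (\<Sum>n\<in>F. (cmod (b n))\<^sup>2))"
    by (simp add: complex_norm_square sum_distrib_left mult_ac flip: of_real_power)
  finally show ?thesis by (simp only: of_real_eq_iff)
qed

text \<open>Growing index squares turn an unordered sum into the limit of a sequence, the form in
  which dominated convergence and measurability of limits apply.\<close>

lemma filterlim_squares:
  "filterlim (\<lambda>N. {..<N} \<times> {..<N}) (finite_subsets_at_top (UNIV :: (nat \<times> nat) set)) sequentially"
  unfolding filterlim_finite_subsets_at_top
proof safe
  fix X :: "(nat \<times> nat) set" assume X: "finite X"
  have "finite (fst ` X \<union> snd ` X)" using X by simp
  then obtain N where N: "\<forall>k\<in>fst ` X \<union> snd ` X. k < N"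
    using finite_nat_set_iff_bounded by blast
  show "\<forall>\<^sub>F M in sequentially. finite ({..<M} \<times> {..<M}) \<and> X \<subseteq> {..<M} \<times> {..<M} \<and> {..<M} \<times> {..<M} \<subseteq> UNIV"
  proof (rule eventually_sequentiallyI)
    fix M assume "N \<le> M"
    have "(k, l) \<in> {..<M} \<times> {..<M}" if "(k, l) \<in> X" for k l
    proof -
      have "k \<in> fst ` X \<union> snd ` X" "l \<in> fst ` X \<union> snd ` X" using that by force+
      then have "k < N" "l < N" using N by blast+
      then show ?thesis using \<open>N \<le> M\<close> by simp
    qed
    then show "finite ({..<M} \<times> {..<M}) \<and> X \<subseteq> {..<M} \<times> {..<M} \<and> {..<M} \<times> {..<M} \<subseteq> UNIV" by auto
  qed
qed

lemma has_sum_squares: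
  fixes f :: "nat \<times> nat \<Rightarrow> 'a::topological_comm_monoid_add"
  assumes "(f has_sum s) UNIV"
  shows "(\<lambda>N. sum f ({..<N} \<times> {..<N})) \<longlonglongrightarrow> s"
  using filterlim_compose[OF assms[unfolded has_sum_def] filterlim_squares] .

text \<open>Absolute summability bounds all partial sums by one constant B, so dominated convergence
  carries the finite identity to the limit. The same B yields square summability of the
  coefficients.\<close>

lemma parseval:
  assumes b: "(\<lambda>n. cmod (b n)) summable_on UNIV"
    and f: "\<And>p. ((\<lambda>n. b n * character n p) has_sum f p) UNIV"
  shows "f \<in> borel_measurable square"
    and "((\<lambda>n. (cmod (b n))\<^sup>2) has_sum (\<integral>p. (cmod (f p))\<^sup>2 \<partial>square) / (4 * pi\<^sup>2)) UNIV"
proof -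
  define P where "P N p = (\<Sum>n\<in>{..<N} \<times> {..<N}. b n * character n p)" for N p
  have P: "(\<lambda>N. P N p) \<longlonglongrightarrow> f p" for p
    unfolding P_def by (rule has_sum_squares[OF f])
  have [measurable]: "P N \<in> borel_measurable square" for N
    unfolding P_def by measurable
  show meas [measurable]: "f \<in> borel_measurable square"
    using P by (rule borel_measurable_LIMSEQ_metric[rotated]) measurable
  define B where "B = (\<Sum>\<^sub>\<infinity>n. cmod (b n))"
  have sum_le: "(\<Sum>n\<in>F. cmod (b n)) \<le> B" if "finite F" for F
    unfolding B_def by (rule finite_sum_le_infsum[OF b that]) simp_all
  have PB: "cmod (P N p) \<le> B" for N p
  proof -
    have "cmod (P N p) \<le> (\<Sum>n\<in>{..<N} \<times> {..<N}. cmod (b n * character n p))"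
      unfolding P_def by (rule norm_sum)
    also have "\<dots> \<le> B" using sum_le[of "{..<N} \<times> {..<N}"] by (simp add: norm_mult)
    finally show ?thesis .
  qed
  have "(\<lambda>N. \<integral>p. (cmod (P N p))\<^sup>2 \<partial>square) \<longlonglongrightarrow> (\<integral>p. (cmod (f p))\<^sup>2 \<partial>square)"
  proof (rule integral_dominated_convergence)
    show "AE p in square. (\<lambda>N. (cmod (P N p))\<^sup>2) \<longlonglongrightarrow> (cmod (f p))\<^sup>2"
      by (intro AE_I2 tendsto_intros P)
    show "AE p in square. norm ((cmod (P N p))\<^sup>2) \<le> B\<^sup>2" for N
      by (intro AE_I2) (simp add: power_mono PB)
    show "integrable square (\<lambda>_. B\<^sup>2)" by (rule square.integrable_const)
  qed measurable
  then have lim: "(\<lambda>N. 4 * pi\<^sup>2 * (\<Sum>n\<in>{..<N} \<times> {..<N}. (cmod (b n))\<^sup>2)) \<longlonglongrightarrow> (\<integral>p. (cmod (f p))\<^sup>2 \<partial>square)"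
    unfolding P_def by (subst (asm) parseval_finite) simp_all
  have "(\<lambda>n. (cmod (b n))\<^sup>2) summable_on UNIV"
  proof (rule summable_on_comparison_test)
    show "(\<lambda>n. B * cmod (b n)) summable_on UNIV" by (rule summable_on_cmult_right[OF b])
    show "(cmod (b n))\<^sup>2 \<le> B * cmod (b n)" for n
      using sum_le[of "{n}"] by (simp add: power2_eq_square mult_right_mono)
  qed simp
  then have hs: "((\<lambda>n. (cmod (b n))\<^sup>2) has_sum (\<Sum>\<^sub>\<infinity>n. (cmod (b n))\<^sup>2)) UNIV"
    by (rule has_sum_infsum)
  have "4 * pi\<^sup>2 * (\<Sum>\<^sub>\<infinity>n. (cmod (b n))\<^sup>2) = (\<integral>p. (cmod (f p))\<^sup>2 \<partial>square)"
    by (rule LIMSEQ_unique[OF tendsto_mult_left[OF has_sum_squares[OF hs]] lim])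
  then have "(\<Sum>\<^sub>\<infinity>n. (cmod (b n))\<^sup>2) = (\<integral>p. (cmod (f p))\<^sup>2 \<partial>square) / (4 * pi\<^sup>2)"
    by (simp add: field_simps)
  then show "((\<lambda>n. (cmod (b n))\<^sup>2) has_sum (\<integral>p. (cmod (f p))\<^sup>2 \<partial>square) / (4 * pi\<^sup>2)) UNIV"
    using hs by simp
qed

lemma parseval_dilate:
  assumes f: "has_power_series f c" and r: "0 \<le> r" "r < 1"
  shows "(\<lambda>p. f (dilate r p)) \<in> borel_measurable square"
    and "((\<lambda>n. (cmod (c n))\<^sup>2 * r ^ (2 * (fst n + snd n))) has_sum
      (\<integral>p. (cmod (f (dilate r p)))\<^sup>2 \<partial>square) / (4 * pi\<^sup>2)) UNIV"
proof -
  define b where "b n = c n * of_real (r ^ (fst n + snd n))" for n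
  \<comment> \<open>Convergence at the diagonal point (r, r) is exactly summability of the dilated
    coefficients, and for complex families summability is absolute.\<close>
  have "(of_real r, of_real r) \<in> bidisk" using r by (simp add: in_bidisk_iff)
  then have "((\<lambda>(k, l). c (k, l) * of_real r ^ k * of_real r ^ l) has_sum f (of_real r, of_real r)) UNIV"
    using f by (auto simp: has_power_series_def)
  then have "b summable_on UNIV"
    by (auto simp: summable_on_def b_def[abs_def] case_prod_unfold power_add mult.assoc)
  then have b: "(\<lambda>n. cmod (b n)) summable_on UNIV"
    using summable_on_iff_abs_summable_on_complex by blast
  have "((\<lambda>n. b n * character n p) has_sum f (dilate r p)) UNIV" for p
  proof -
    have "dilate r p \<in> bidisk" using r by (simp add: in_bidisk_iff dilate_def norm_mult)
    then have "((\<lambda>(k, l). c (k, l) * fst (dilate r p) ^ k * snd (dilate r p) ^ l) has_sum f (dilate r p)) UNIV"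
      using f by (auto simp: has_power_series_def)
    then show ?thesis
      by (simp add: b_def case_prod_unfold dilate_def character_def power_add power_mult_distrib mult_ac)
  qed
  note P = parseval[OF b this]
  show "(\<lambda>p. f (dilate r p)) \<in> borel_measurable square" by (rule P(1))
  show "((\<lambda>n. (cmod (c n))\<^sup>2 * r ^ (2 * (fst n + snd n))) has_sum
      (\<integral>p. (cmod (f (dilate r p)))\<^sup>2 \<partial>square) / (4 * pi\<^sup>2)) UNIV"
    using P(2) r
    by (simp add: b_def norm_mult norm_power power_mult_distrib power_mult[symmetric] mult.commute)
qed

section \<open>Passage from dilated tori to the boundary\<close>

definition radius :: "nat \<Rightarrow> real" where "radius N = 1 - 1 / real (Suc N)"

lemma radius: "0 \<le> radius N" "radius N < 1" "radius \<longlonglongrightarrow> 1"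
proof -
  show "0 \<le> radius N" "radius N < 1" by (simp_all add: radius_def)
  have "(\<lambda>N. 1 - 1 / real (Suc N)) \<longlonglongrightarrow> 1 - 0"
    by (intro tendsto_intros LIMSEQ_Suc[OF lim_1_over_n])
  then show "radius \<longlonglongrightarrow> 1" by (simp add: radius_def[abs_def])
qed

text \<open>G need only be the limit of squared moduli, so f itself may lack a boundary function.
  Dominated convergence sends the means to the integral of G; finite coefficient sums stay below
  this limit, while each mean is at most the full sum because \<open>radius N\<close> is at most
  1.\<close>

lemma square_mean_boundary:
  assumes f: "has_power_series f c" and bdd: "\<And>z. z \<in> bidisk \<Longrightarrow> cmod (f z) \<le> B"
    and G [measurable]: "G \<in> borel_measurable square"
    and lim: "AE p in square. (\<lambda>N. (cmod (f (dilate (radius N) p)))\<^sup>2) \<longlonglongrightarrow> G p"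
  shows "((\<lambda>n. (cmod (c n))\<^sup>2) has_sum (\<integral>p. G p \<partial>square) / (4 * pi\<^sup>2)) UNIV"
proof -
  define I where "I N = (\<integral>p. (cmod (f (dilate (radius N) p)))\<^sup>2 \<partial>square) / (4 * pi\<^sup>2)" for N
  note [measurable] = parseval_dilate(1)[OF f radius(1,2)]
  have I: "((\<lambda>n. (cmod (c n))\<^sup>2 * radius N ^ (2 * (fst n + snd n))) has_sum I N) UNIV" for N
    unfolding I_def by (rule parseval_dilate(2)[OF f radius(1,2)])
  have Ilim: "I \<longlonglongrightarrow> (\<integral>p. G p \<partial>square) / (4 * pi\<^sup>2)"
    unfolding I_def
  proof (intro tendsto_divide tendsto_const integral_dominated_convergence)
    show "AE p in square. norm ((cmod (f (dilate (radius N) p)))\<^sup>2) \<le> B\<^sup>2" for N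
    proof (rule AE_I2)
      fix p
      have "dilate (radius N) p \<in> bidisk"
        using radius(1,2)[of N] by (simp add: in_bidisk_iff dilate_def norm_mult)
      then show "norm ((cmod (f (dilate (radius N) p)))\<^sup>2) \<le> B\<^sup>2"
        by (simp add: power_mono bdd)
    qed
    show "integrable square (\<lambda>_. B\<^sup>2)" by (rule square.integrable_const)
  qed (use lim in simp_all)
  define S where "S = (\<integral>p. G p \<partial>square) / (4 * pi\<^sup>2)"
  have fin_lim: "(\<lambda>N. \<Sum>n\<in>F. (cmod (c n))\<^sup>2 * radius N ^ (2 * (fst n + snd n))) \<longlonglongrightarrow> (\<Sum>n\<in>F. (cmod (c n))\<^sup>2 * 1 ^ (2 * (fst n + snd n)))" for F
    by (intro tendsto_intros radius(3))
  have fin_le: "(\<Sum>n\<in>F. (cmod (c n))\<^sup>2) \<le> S" if F: "finite F" for F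
  proof (rule LIMSEQ_le)
    show "(\<lambda>N. \<Sum>n\<in>F. (cmod (c n))\<^sup>2 * radius N ^ (2 * (fst n + snd n))) \<longlonglongrightarrow> (\<Sum>n\<in>F. (cmod (c n))\<^sup>2)"
      using fin_lim[of F] by simp
    show "I \<longlonglongrightarrow> S" unfolding S_def by (rule Ilim)
    show "\<exists>N. \<forall>n\<ge>N. (\<Sum>m\<in>F. (cmod (c m))\<^sup>2 * radius n ^ (2 * (fst m + snd m))) \<le> I n"
      by (intro exI allI impI finite_sum_le_has_sum[OF I F]) (simp_all add: radius)
  qed
  have summ: "(\<lambda>n. (cmod (c n))\<^sup>2) summable_on UNIV"
    by (rule nonneg_bdd_above_summable_on) (use fin_le in \<open>auto intro!: bdd_aboveI2\<close>)
  have "(\<Sum>\<^sub>\<infinity>n. (cmod (c n))\<^sup>2) = S"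
  proof (rule antisym)
    show "(\<Sum>\<^sub>\<infinity>n. (cmod (c n))\<^sup>2) \<le> S" by (rule infsum_le_finite_sums[OF summ fin_le])
    show "S \<le> (\<Sum>\<^sub>\<infinity>n. (cmod (c n))\<^sup>2)"
    proof (rule LIMSEQ_le_const2)
      show "I \<longlonglongrightarrow> S" unfolding S_def by (rule Ilim)
      have "I N \<le> (\<Sum>\<^sub>\<infinity>n. (cmod (c n))\<^sup>2)" for N
        by (rule has_sum_mono[OF I has_sum_infsum[OF summ]])
          (simp add: mult_left_le power_le_one radius less_imp_le)
      then show "\<exists>N. \<forall>n\<ge>N. I n \<le> (\<Sum>\<^sub>\<infinity>n. (cmod (c n))\<^sup>2)" by blast
    qed
  qed
  then show ?thesis using has_sum_infsum[OF summ] by (simp add: S_def)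
qed

text \<open>The torus measure is the image of the uniform measure on the angle square, so properties
  pull back along \<open>dilate 1\<close>; normalisation by a positive finite constant does not
  change null sets.\<close>

lemma AE_square_of_AE_torus:
  assumes "AE \<zeta> in torus_measure. P \<zeta>"
  shows "AE p in square. P (dilate 1 p)"
proof -
  let ?S = "{0..2 * pi} \<times> {0..2 * pi} :: (real \<times> real) set"
  have S: "?S = cbox (0, 0) (2 * pi, 2 * pi)" by (auto simp: cbox_Pair_eq cbox_interval)
  have "AE p in uniform_measure lborel ?S. P ((\<lambda>(s, t). (cis s, cis t)) p)"
  proof (rule AE_distrD[where M' = borel and P = P])
    have "continuous_on UNIV (\<lambda>p::real \<times> real. (cis (fst p), cis (snd p)))"
      by (intro continuous_intros)
    then have "(\<lambda>p::real \<times> real. (cis (fst p), cis (snd p))) \<in> borel_measurable borel"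
      by (rule borel_measurable_continuous_onI)
    then show "(\<lambda>(s, t). (cis s, cis t)) \<in> uniform_measure lborel ?S \<rightarrow>\<^sub>M borel"
      by (simp add: case_prod_unfold)
    show "AE \<zeta> in distr (uniform_measure lborel ?S) borel (\<lambda>(s, t). (cis s, cis t)). P \<zeta>"
      using assms unfolding torus_measure_def .
  qed
  then have "AE p in lborel. p \<in> ?S \<longrightarrow> P ((\<lambda>(s, t). (cis s, cis t)) p)"
    by (subst (asm) AE_uniform_measure)
      (simp_all add: S emeasure_lborel_cbox_eq Basis_prod_def)
  then show ?thesis
    unfolding square_def S
    by (subst AE_restrict_space_iff) (simp_all add: dilate_def case_prod_unfold)
qed

lemma nontangential_limit_imp_radial:
  assumes lim: "has_nontangential_limit f (dilate 1 p) L"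
  shows "(\<lambda>N. f (dilate (radius N) p)) \<longlonglongrightarrow> L"
proof -
  \<comment> \<open>A radial point at radius r has distance 1 - r from its boundary point, so every
    aperture above 1 contains it; 2 is one such choice.\<close>
  define S where "S = stolz_region 2 (fst (dilate 1 p)) \<times> stolz_region 2 (snd (dilate 1 p))"
  have "(f \<longlongrightarrow> L) (at (dilate 1 p) within S)"
    using lim by (simp add: has_nontangential_limit_def S_def)
  moreover have "filterlim (\<lambda>N. dilate (radius N) p) (at (dilate 1 p) within S) sequentially"
    unfolding filterlim_at
  proof (intro conjI always_eventually allI)
    have "(\<lambda>N. dilate (radius N) p) \<longlonglongrightarrow> (of_real 1 * cis (fst p), of_real 1 * cis (snd p))"
      unfolding dilate_def by (intro tendsto_intros radius(3))
    then show "(\<lambda>N. dilate (radius N) p) \<longlonglongrightarrow> dilate 1 p" by (simp add: dilate_def)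
    fix N
    have stolz: "of_real (radius N) * cis t \<in> stolz_region 2 (cis t)" for t
    proof -
      have "of_real (radius N) * cis t - cis t = of_real (radius N - 1) * cis t"
        by (simp add: algebra_simps)
      then have "cmod (of_real (radius N) * cis t - cis t) = 1 - radius N"
        using radius(2)[of N] by (simp add: norm_mult del: of_real_diff)
      then show ?thesis using radius(1,2)[of N] by (simp add: stolz_region_def norm_mult)
    qed
    then show "dilate (radius N) p \<in> S" by (simp add: S_def dilate_def)
    \<comment> \<open>The filter \<open>at\<close> excludes the limit point; the moduli already
      differ because \<open>radius N\<close> is less than 1.\<close>
    have "cmod (fst (dilate (radius N) p)) \<noteq> cmod (fst (dilate 1 p))"
      using radius(1,2)[of N] by (simp add: dilate_def norm_mult)
    then show "dilate (radius N) p \<noteq> dilate 1 p" by metis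
  qed
  ultimately show ?thesis by (rule filterlim_compose)
qed

subsection \<open>Multiplication by an inner function\<close>

lemma AE_inner_function_radial:
  assumes "inner_function \<phi>"
  shows "AE p in square. (\<lambda>N. cmod (\<phi> (dilate (radius N) p))) \<longlonglongrightarrow> 1"
proof -
  have "AE p in square. \<exists>L. has_nontangential_limit \<phi> (dilate 1 p) L \<and> cmod L = 1"
    using assms unfolding inner_function_def by (intro AE_square_of_AE_torus) blast
  then show ?thesis
    by eventually_elim (metis nontangential_limit_imp_radial tendsto_norm)
qed

lemma inner_mult_finite_support:
  assumes \<phi>: "inner_function \<phi>" and F: "finite F" "\<And>n. n \<notin> F \<Longrightarrow> coef b n = 0"
  shows "\<exists>h. norm h = norm b \<and> (\<forall>z\<in>bidisk. eval h z = \<phi> z * eval b z)"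
proof -
  define P where "P z w = (\<Sum>n\<in>F. coef b n * z ^ fst n * w ^ snd n)" for z w
  have P_eval: "eval b z = P (fst z) (snd z)" if "z \<in> bidisk" for z
  proof -
    have "((\<lambda>(k, l). coef b (k, l) * fst z ^ k * snd z ^ l) has_sum eval b z) UNIV"
      using has_power_series_eval that unfolding has_power_series_def by blast
    moreover have "((\<lambda>(k, l). coef b (k, l) * fst z ^ k * snd z ^ l) has_sum P (fst z) (snd z)) UNIV"
      by (rule has_sum_finite_neutralI[OF F(1)]) (auto simp: F(2) P_def case_prod_unfold)
    ultimately show ?thesis by (rule has_sum_unique)
  qed
  have P_series: "has_power_series (\<lambda>z. P (fst z) (snd z)) (coef b)"
    using has_power_series_cong[of "eval b" "\<lambda>z. P (fst z) (snd z)"] P_eval has_power_series_eval by blast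
  define A where "A = (\<Sum>n\<in>F. cmod (coef b n))"
  have P_le: "cmod (P z w) \<le> A" if "cmod z < 1" "cmod w < 1" for z w
    unfolding P_def A_def
  proof (rule sum_norm_le)
    fix n
    have "cmod z ^ fst n * cmod w ^ snd n \<le> 1"
      using that by (intro mult_le_one power_le_one zero_le_power) auto
    then show "cmod (coef b n * z ^ fst n * w ^ snd n) \<le> cmod (coef b n)"
      by (simp add: norm_mult norm_power mult.assoc mult_left_le)
  qed
  obtain B where B: "\<And>z. z \<in> bidisk \<Longrightarrow> cmod (\<phi> z) \<le> B"
    using \<phi> unfolding inner_function_def bounded_iff by blast
  have hol: "holomorphic2_on \<phi> bidisk" using \<phi> by (simp add: inner_function_def)
  have \<phi>P_le: "cmod (\<phi> (z, w) * P z w) \<le> B * A" if "cmod z < 1" "cmod w < 1" for z w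
    unfolding norm_mult using that B[of "(z, w)"] P_le[OF that] order_trans[OF norm_ge_zero B[of "(z, w)"]]
    by (intro mult_mono) (auto simp: in_bidisk_iff)
  have "\<exists>c. has_power_series (\<lambda>z. (\<lambda>z w. \<phi> (z, w) * P z w) (fst z) (snd z)) c"
  proof (rule bounded_separately_holomorphic_power_series)
    show "(\<lambda>z. \<phi> (z, w) * P z w) holomorphic_on ball 0 1" if "cmod w < 1" for w
      unfolding P_def
      by (intro holomorphic_intros holomorphic2_imp_separately_holomorphic(1)[OF hol] that)
    show "(\<lambda>w. \<phi> (z, w) * P z w) holomorphic_on ball 0 1" if "cmod z < 1" for z
      unfolding P_def
      by (intro holomorphic_intros holomorphic2_imp_separately_holomorphic(2)[OF hol] that)
  qed (rule \<phi>P_le)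
  then obtain c where c: "has_power_series (\<lambda>z. \<phi> z * P (fst z) (snd z)) c" by auto
  \<comment> \<open>One G serves two applications of \<open>square_mean_boundary\<close>: to P by
    continuity, and to the product with \<phi> because the radial limits of its modulus are 1 almost
    everywhere.\<close>
  define G where "G p = (cmod (P (cis (fst p)) (cis (snd p))))\<^sup>2" for p
  have G: "G \<in> borel_measurable square"
    unfolding G_def P_def
    by (intro measurable_square borel_measurable_continuous_onI continuous_intros)
  have P_lim: "(\<lambda>N. (cmod (P (fst (dilate (radius N) p)) (snd (dilate (radius N) p))))\<^sup>2) \<longlonglongrightarrow> G p" for p
  proof -
    have "(\<lambda>N. (cmod (P (fst (dilate (radius N) p)) (snd (dilate (radius N) p))))\<^sup>2)
        \<longlonglongrightarrow> (cmod (P (of_real 1 * cis (fst p)) (of_real 1 * cis (snd p))))\<^sup>2"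
      unfolding P_def dilate_def fst_conv snd_conv by (intro tendsto_intros radius(3))
    then show ?thesis by (simp add: G_def)
  qed
  have sum_c: "((\<lambda>n. (cmod (c n))\<^sup>2) has_sum (\<integral>p. G p \<partial>square) / (4 * pi\<^sup>2)) UNIV"
  proof (rule square_mean_boundary[OF c _ G])
    show "cmod (\<phi> z * P (fst z) (snd z)) \<le> B * A" if "z \<in> bidisk" for z
      using \<phi>P_le[of "fst z" "snd z"] that by (simp add: in_bidisk_iff)
    show "AE p in square. (\<lambda>N. (cmod (\<phi> (dilate (radius N) p) *
        P (fst (dilate (radius N) p)) (snd (dilate (radius N) p))))\<^sup>2) \<longlonglongrightarrow> G p"
      using AE_inner_function_radial[OF \<phi>]
    proof eventually_elim
      case (elim p)
      from tendsto_mult[OF tendsto_power[OF elim, of 2] P_lim[of p]]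
      show ?case by (simp add: norm_mult power_mult_distrib)
    qed
  qed
  have sum_b: "((\<lambda>n. (cmod (coef b n))\<^sup>2) has_sum (\<integral>p. G p \<partial>square) / (4 * pi\<^sup>2)) UNIV"
  proof (rule square_mean_boundary[OF P_series _ G])
    show "cmod (P (fst z) (snd z)) \<le> A" if "z \<in> bidisk" for z
      using P_le that by (simp add: in_bidisk_iff)
  qed (use P_lim in simp)
  have coef: "coef (Ell2 c) = c" using sum_c by (intro coef_Ell2) (auto simp: summable_on_def)
  have "(norm (Ell2 c))\<^sup>2 = (norm b)\<^sup>2"
    unfolding norm_ell2_sq coef using infsumI[OF sum_c] infsumI[OF sum_b] by simp
  then have "norm (Ell2 c) = norm b" by (rule power2_eq_imp_eq) simp_all
  moreover have "eval (Ell2 c) z = \<phi> z * eval b z" if z: "z \<in> bidisk" for z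
  proof -
    have "has_power_series (eval (Ell2 c)) c" using has_power_series_eval[of "Ell2 c"] coef by simp
    then show ?thesis
      using c z unfolding has_power_series_def P_eval[OF z] by (blast intro: has_sum_unique)
  qed
  ultimately show ?thesis by blast
qed

section \<open>Extension of the isometry from polynomials to the whole Hardy space\<close>

lemma eval_inject:
  assumes "\<And>z. z \<in> bidisk \<Longrightarrow> eval a z = eval b z"
  shows "a = b"
  using hardy_space_evalI(2)[of "eval a" b] assms by simp

text \<open>Polynomial approximants b k converge to g, and their products with \<phi> form a Cauchy
  sequence because differences keep their norm. Continuity of evaluation identifies the limit as the
  product of \<phi> and g on the bidisk.\<close>

lemma ex_inner_mult:
  assumes \<phi>: "inner_function \<phi>"
  shows "\<exists>h. norm h = norm g \<and> (\<forall>z\<in>bidisk. eval h z = \<phi> z * eval g z)"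
proof -
  define fin where "fin b \<longleftrightarrow> (\<exists>F. finite F \<and> (\<forall>n. n \<notin> F \<longrightarrow> coef b n = 0))" for b :: "(nat \<times> nat) ell2"
  have fin_diff: "fin (a - b)" if ab: "fin a" "fin b" for a b
  proof -
    obtain F G where "finite F" "\<And>n. n \<notin> F \<Longrightarrow> coef a n = 0" "finite G" "\<And>n. n \<notin> G \<Longrightarrow> coef b n = 0"
      using ab unfolding fin_def by auto
    then show ?thesis unfolding fin_def by (intro exI[of _ "F \<union> G"]) auto
  qed
  have "\<exists>b. fin b \<and> norm (g - b) < 1 / real (Suc k)" for k
    using finite_support_dense[of "1 / real (Suc k)" g] by (auto simp: fin_def)
  then obtain b where b: "\<And>k. fin (b k)" "\<And>k. norm (g - b k) < 1 / real (Suc k)" by metis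
  have b_lim: "b \<longlonglongrightarrow> g"
  proof -
    have "(\<lambda>k. norm (g - b k)) \<longlonglongrightarrow> 0"
      using b(2) by (intro tendsto_sandwich[OF _ _ tendsto_const LIMSEQ_Suc[OF lim_1_over_n]])
        (auto intro!: always_eventually less_imp_le)
    then show ?thesis unfolding tendsto_dist_iff[of b] dist_norm by (simp only: norm_minus_commute)
  qed
  have "\<exists>h. norm h = norm (b k) \<and> (\<forall>z\<in>bidisk. eval h z = \<phi> z * eval (b k) z)" for k
    using b(1)[of k] inner_mult_finite_support[OF \<phi>] unfolding fin_def by metis
  then obtain h where h: "\<And>k. norm (h k) = norm (b k)" "\<And>k z. z \<in> bidisk \<Longrightarrow> eval (h k) z = \<phi> z * eval (b k) z"
    by metis
  \<comment> \<open>The isometry is so far known only for single finitely supported vectors. It is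
    applied to b k - b l, whose product with \<phi> has the same values as h k - h l and hence the
    same coefficients.\<close>
  have h_diff: "norm (h k - h l) = norm (b k - b l)" for k l
  proof -
    obtain d where d: "norm d = norm (b k - b l)" "\<And>z. z \<in> bidisk \<Longrightarrow> eval d z = \<phi> z * eval (b k - b l) z"
      using fin_diff[OF b(1) b(1), of k l] inner_mult_finite_support[OF \<phi>] unfolding fin_def by metis
    have "d = h k - h l"
      by (rule eval_inject) (simp add: d(2) h(2) eval_simps algebra_simps)
    then show ?thesis using d(1) by simp
  qed
  have "Cauchy h"
    using LIMSEQ_imp_Cauchy[OF b_lim] unfolding Cauchy_def dist_norm h_diff .
  then obtain h' where h': "h \<longlonglongrightarrow> h'" using Cauchy_convergent convergent_def by blast
  have "norm h' = norm g"
    by (rule LIMSEQ_unique[OF tendsto_norm[OF h']]) (simp add: h(1) tendsto_norm[OF b_lim])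
  moreover have "eval h' z = \<phi> z * eval g z" if z: "z \<in> bidisk" for z
    by (rule LIMSEQ_unique[OF tendsto_eval[OF h']])
      (simp add: h(2)[OF z] tendsto_mult_left[OF tendsto_eval[OF b_lim]])
  ultimately show ?thesis by blast
qed

text \<open>Multiplication by \<phi> transported to coefficients. It has its intended meaning for
  inner \<phi>, when \<open>ex_inner_mult\<close> puts the product into the Hardy space.\<close>

definition inner_mult :: "(complex \<times> complex \<Rightarrow> complex) \<Rightarrow> (nat \<times> nat) ell2 \<Rightarrow> (nat \<times> nat) ell2"
  where "inner_mult \<phi> g = hardy_coef (\<lambda>z. \<phi> z * eval g z)"

lemma
  assumes "inner_function \<phi>"
  shows eval_inner_mult: "\<And>z. z \<in> bidisk \<Longrightarrow> eval (inner_mult \<phi> g) z = \<phi> z * eval g z"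
    and norm_inner_mult: "norm (inner_mult \<phi> g) = norm g"
proof -
  obtain h where h: "norm h = norm g" "\<forall>z\<in>bidisk. eval h z = \<phi> z * eval g z"
    using ex_inner_mult[OF assms] by blast
  have *: "hardy_coef (\<lambda>z. \<phi> z * eval g z) = h"
    using hardy_space_evalI(2)[of "\<lambda>z. \<phi> z * eval g z" h] h(2) by simp
  show "norm (inner_mult \<phi> g) = norm g" by (simp add: inner_mult_def * h(1))
  show "eval (inner_mult \<phi> g) z = \<phi> z * eval g z" if "z \<in> bidisk" for z
    using h(2) that by (simp add: inner_mult_def *)
qed

text \<open>Polarisation turns preservation of norms into preservation of the real inner product;
  commutation with \<open>cmul \<i>\<close> then gives the imaginary part.\<close>

lemma cinner_inner_mult:
  assumes \<phi>: "inner_function \<phi>"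
  shows "cinner (inner_mult \<phi> a) (inner_mult \<phi> b) = cinner a b"
proof -
  have add: "inner_mult \<phi> (a + b) = inner_mult \<phi> a + inner_mult \<phi> b" for a b
    by (rule eval_inject) (simp add: eval_inner_mult[OF \<phi>] eval_simps algebra_simps)
  have cmul: "inner_mult \<phi> (cmul c a) = cmul c (inner_mult \<phi> a)" for c a
    by (rule eval_inject) (simp add: eval_inner_mult[OF \<phi>] eval_simps algebra_simps)
  have inner: "inner (inner_mult \<phi> a) (inner_mult \<phi> b) = inner a b" for a b
    using norm_inner_mult[OF \<phi>, of "a + b"] norm_inner_mult[OF \<phi>, of a] norm_inner_mult[OF \<phi>, of b]
    unfolding add by (simp add: dot_norm)
  show ?thesis unfolding cinner_eq_inner by (simp add: inner flip: cmul)
qed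

subsection \<open>The model space\<close>

text \<open>The orthogonal complement of the range of multiplication by \<phi>. As an intersection
  of kernels of continuous functionals it is a closed complex subspace, as Riesz representation
  requires.\<close>

definition model_coefs :: "(complex \<times> complex \<Rightarrow> complex) \<Rightarrow> (nat \<times> nat) ell2 set"
  where "model_coefs \<phi> = {a. \<forall>g. cinner a (inner_mult \<phi> g) = 0}"

text \<open>Every coefficient vector belongs to a Hardy space function, namely its
  \<open>eval\<close>, so testing orthogonality against functions and against vectors is the same
  condition.\<close>

lemma model_space_iff:
  assumes \<phi>: "inner_function \<phi>"
  shows "f \<in> model_space \<phi> \<longleftrightarrow> f \<in> hardy_space \<and> hardy_coef f \<in> model_coefs \<phi>"
proof (cases "f \<in> hardy_space")
  case True
  have "hardy_inner f (\<lambda>z. \<phi> z * g z) = cinner (hardy_coef f) (inner_mult \<phi> (hardy_coef g))"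
    if g: "g \<in> hardy_space" for g
  proof -
    have "\<phi> z * g z = eval (inner_mult \<phi> (hardy_coef g)) z" if "z \<in> bidisk" for z
      by (simp add: eval_inner_mult[OF \<phi> that] eval_hardy_coef[OF g that])
    from hardy_space_evalI[of "\<lambda>z. \<phi> z * g z", OF this]
    show ?thesis using True by (simp add: hardy_inner_eq)
  qed
  moreover have "\<exists>g\<in>hardy_space. hardy_coef g = a" for a
    by (intro bexI[of _ "eval a"]) simp_all
  ultimately show ?thesis using True unfolding model_space_def model_coefs_def by auto metis
qed (simp add: model_space_def)

lemma eval_in_model_space:
  "inner_function \<phi> \<Longrightarrow> eval a \<in> model_space \<phi> \<longleftrightarrow> a \<in> model_coefs \<phi>"
  by (simp add: model_space_iff)

lemma model_coefs_closed_subspace: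
  "subspace (model_coefs \<phi>)" "closed (model_coefs \<phi>)"
  "a \<in> model_coefs \<phi> \<Longrightarrow> cmul c a \<in> model_coefs \<phi>"
proof -
  have "cinner 0 b = 0" for b :: "(nat \<times> nat) ell2" by (simp add: cinner_def)
  then show "subspace (model_coefs \<phi>)"
    by (auto simp: subspace_def model_coefs_def cinner_add_left cinner_cmul_left simp flip: cmul_of_real)
  show "a \<in> model_coefs \<phi> \<Longrightarrow> cmul c a \<in> model_coefs \<phi>"
    by (simp add: model_coefs_def cinner_cmul_left)
  have "closed {a. cinner a (inner_mult \<phi> g) = 0}" for g
    by (intro closed_Collect_eq continuous_on_const)
      (auto simp: continuous_on_def intro: tendsto_cinner_left)
  moreover have "model_coefs \<phi> = (\<Inter>g. {a. cinner a (inner_mult \<phi> g) = 0})"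
    by (auto simp: model_coefs_def)
  ultimately show "closed (model_coefs \<phi>)" by auto
qed

text \<open>The kernel is k = \<open>kern w\<close> minus \<open>cnj (\<phi> w)\<close> times \<phi>
  \<open>kern w\<close>. Against \<phi> g both terms give the conjugate of \<phi>(w) g(w), the first
  by reproduction and the second by the isometry, so they cancel. Against an element of the model
  space the second term vanishes, leaving the Szego kernel to reproduce the value.\<close>

lemma
  assumes \<phi>: "inner_function \<phi>" and w: "w \<in> bidisk"
  shows model_kernel_in_model_space: "model_kernel \<phi> w \<in> model_space \<phi>"
    and model_kernel_reproducing:
      "\<And>f. f \<in> model_space \<phi> \<Longrightarrow> hardy_inner f (model_kernel \<phi> w) = f w"
proof -
  define k where "k = kern w - cmul (cnj (\<phi> w)) (inner_mult \<phi> (kern w))"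
  have "model_kernel \<phi> w z = eval k z" if "z \<in> bidisk" for z
    by (simp add: k_def model_kernel_def eval_simps eval_inner_mult[OF \<phi> that] eval_kern[OF that w]
        szego_kernel_def diff_divide_distrib mult.commute)
  note K = hardy_space_evalI[of "model_kernel \<phi> w" k, OF this]
  have "cinner k (inner_mult \<phi> g) = 0" for g
  proof -
    have "cinner (kern w) (inner_mult \<phi> g) = cnj (\<phi> w) * cnj (eval g w)"
      using eval_inner_mult[OF \<phi> w, of g] by (subst cinner_commute) (simp flip: eval_def)
    moreover have "cinner (inner_mult \<phi> (kern w)) (inner_mult \<phi> g) = cnj (eval g w)"
      unfolding cinner_inner_mult[OF \<phi>] by (subst cinner_commute) (simp add: eval_def)
    ultimately show ?thesis by (simp add: k_def cinner_diff_left cinner_cmul_left)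
  qed
  then show "model_kernel \<phi> w \<in> model_space \<phi>"
    using K by (simp add: model_space_iff[OF \<phi>] model_coefs_def)
  show "hardy_inner f (model_kernel \<phi> w) = f w" if f: "f \<in> model_space \<phi>" for f
  proof -
    have "f \<in> hardy_space" "hardy_coef f \<in> model_coefs \<phi>"
      using f by (simp_all add: model_space_iff[OF \<phi>])
    then show ?thesis
      using eval_hardy_coef[OF _ w, of f]
      by (simp add: hardy_inner_eq K k_def cinner_diff_right cinner_cmul_right model_coefs_def
          flip: eval_def)
  qed
qed

subsection \<open>Square-integrable functions\<close>

lemma borel_measurable_cnj_comp:
  fixes h :: "'a \<Rightarrow> complex"
  assumes "h \<in> borel_measurable M"
  shows "(\<lambda>x. cnj (h x)) \<in> borel_measurable M"
  by (rule borel_measurable_continuous_on[OF _ assms]) (intro continuous_intros)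

text \<open>Both claims rest on the pointwise inequality between geometric and arithmetic mean. The
  resulting bound is not homogeneous, but on unit vectors it suffices for boundedness of a linear
  functional.\<close>

lemma
  assumes g: "g \<in> L2_space M" and h: "h \<in> L2_space M"
  shows L2_integrable_mult: "integrable M (\<lambda>x. g x * cnj (h x))"
    and cmod_L2_inner_le: "cmod (L2_inner M g h) \<le> ((L2_norm M g)\<^sup>2 + (L2_norm M h)\<^sup>2) / 2"
proof -
  have [measurable]: "g \<in> borel_measurable M" "(\<lambda>x. cnj (h x)) \<in> borel_measurable M"
    using g h by (auto simp: L2_space_def borel_measurable_cnj_comp)
  have int: "integrable M (\<lambda>x. (cmod (g x))\<^sup>2)" "integrable M (\<lambda>x. (cmod (h x))\<^sup>2)"
    using g h by (auto simp: L2_space_def)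
  have le: "cmod (g x * cnj (h x)) \<le> ((cmod (g x))\<^sup>2 + (cmod (h x))\<^sup>2) / 2" for x
    using zero_le_power2[of "cmod (g x) - cmod (h x)"] by (simp add: norm_mult power2_diff)
  have int': "integrable M (\<lambda>x. ((cmod (g x))\<^sup>2 + (cmod (h x))\<^sup>2) / 2)" using int by simp
  show gh: "integrable M (\<lambda>x. g x * cnj (h x))"
  proof (rule Bochner_Integration.integrable_bound[OF int'])
    show "AE x in M. norm (g x * cnj (h x)) \<le> norm (((cmod (g x))\<^sup>2 + (cmod (h x))\<^sup>2) / 2)"
      using le by (intro AE_I2) (smt (verit) real_norm_def)
  qed measurable
  have "cmod (L2_inner M g h) \<le> (\<integral>x. cmod (g x * cnj (h x)) \<partial>M)"
    unfolding L2_inner_def by (rule integral_norm_bound)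
  also have "\<dots> \<le> (\<integral>x. ((cmod (g x))\<^sup>2 + (cmod (h x))\<^sup>2) / 2 \<partial>M)"
    using gh int' le by (intro integral_mono integrable_norm)
  also have "\<dots> = ((L2_norm M g)\<^sup>2 + (L2_norm M h)\<^sup>2) / 2"
    using int by (simp add: L2_norm_def)
  finally show "cmod (L2_inner M g h) \<le> ((L2_norm M g)\<^sup>2 + (L2_norm M h)\<^sup>2) / 2" .
qed

lemma L2_inner_cong_AE:
  assumes "AE x in M. g x = g' x" "g \<in> borel_measurable M" "g' \<in> borel_measurable M" "h \<in> borel_measurable M"
  shows "L2_inner M g h = L2_inner M g' h"
proof -
  note [measurable] = assms(2,3) borel_measurable_cnj_comp[OF assms(4)]
  show ?thesis unfolding L2_inner_def
  proof (rule integral_cong_AE)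
    show "AE x in M. g x * cnj (h x) = g' x * cnj (h x)" using assms(1) by eventually_elim simp
  qed measurable
qed

lemma L2_inner_add:
  assumes "g \<in> L2_space M" "g' \<in> L2_space M" "h \<in> L2_space M"
  shows "L2_inner M (\<lambda>x. g x + g' x) h = L2_inner M g h + L2_inner M g' h"
  unfolding L2_inner_def distrib_right
  by (rule Bochner_Integration.integral_add) (intro L2_integrable_mult assms)+

lemma L2_inner_cmult: "L2_inner M (\<lambda>x. c * g x) h = c * L2_inner M g h"
  by (simp add: L2_inner_def mult.assoc)

lemma L2_norm_zero_imp_AE_zero:
  assumes g: "g \<in> L2_space M" and "L2_norm M g = 0"
  shows "AE x in M. g x = 0"
proof -
  have "(\<integral>x. (cmod (g x))\<^sup>2 \<partial>M) = 0" using assms(2) by (simp add: L2_norm_def)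
  then have "AE x in M. (cmod (g x))\<^sup>2 = 0"
    using g by (subst (asm) integral_nonneg_eq_0_iff_AE) (auto simp: L2_space_def)
  then show ?thesis by simp
qed

subsection \<open>The adjoint of the Clark embedding\<close>

lemma ex_clark_adjoint:
  assumes \<phi>: "inner_function \<phi>" and J: "clark_embedding \<phi> \<alpha> \<sigma> J" and h: "h \<in> L2_space \<sigma>"
  shows "\<exists>g\<in>model_space \<phi>. \<forall>f\<in>model_space \<phi>. L2_inner \<sigma> (J f) h = hardy_inner f g"
proof -
  have J_L2: "J f \<in> L2_space \<sigma>" and J_norm: "L2_norm \<sigma> (J f) = hardy_norm f" if "f \<in> model_space \<phi>" for f
    using J that by (auto simp: clark_embedding_def)
  have J_add: "AE \<zeta> in \<sigma>. J (\<lambda>z. f z + g z) \<zeta> = J f \<zeta> + J g \<zeta>"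
    if "f \<in> model_space \<phi>" "g \<in> model_space \<phi>" for f g
    using J that by (auto simp: clark_embedding_def)
  have J_cmult: "AE \<zeta> in \<sigma>. J (\<lambda>z. c * f z) \<zeta> = c * J f \<zeta>" if "f \<in> model_space \<phi>" for c f
    using J that by (auto simp: clark_embedding_def)
  have meas: "f \<in> borel_measurable \<sigma>" if "f \<in> L2_space \<sigma>" for f
    using that by (simp add: L2_space_def)
  \<comment> \<open>Additivity of J holds only almost everywhere, which the integral does not see.
    Membership of the sum in the model space supplies measurability of its image.\<close>
  have inner_add: "L2_inner \<sigma> (J (\<lambda>z. f z + g z)) h = L2_inner \<sigma> (J f) h + L2_inner \<sigma> (J g) h"
    if f: "f \<in> model_space \<phi>" and g: "g \<in> model_space \<phi>" and fg: "(\<lambda>z. f z + g z) \<in> model_space \<phi>" for f g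
    using L2_inner_cong_AE[OF J_add[OF f g]] meas[OF J_L2[OF fg]] meas[OF J_L2[OF f]] meas[OF J_L2[OF g]]
      meas[OF h] L2_inner_add[OF J_L2[OF f] J_L2[OF g] h] by simp
  have inner_cmult: "L2_inner \<sigma> (J (\<lambda>z. c * f z)) h = c * L2_inner \<sigma> (J f) h"
    if f: "f \<in> model_space \<phi>" and cf: "(\<lambda>z. c * f z) \<in> model_space \<phi>" for c f
    using L2_inner_cong_AE[OF J_cmult[OF f]] meas[OF J_L2[OF cf]] meas[OF J_L2[OF f]] meas[OF h]
    by (simp add: L2_inner_cmult)
  let ?V = "model_coefs \<phi>"
  note V = model_coefs_closed_subspace[where \<phi> = \<phi>]
  define T where "T a = L2_inner \<sigma> (J (eval a)) h" for a
  have T_add: "T (a + b) = T a + T b" if "a \<in> ?V" "b \<in> ?V" for a b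
  proof -
    have "eval (a + b) = (\<lambda>z. eval a z + eval b z)" by (simp add: fun_eq_iff eval_simps)
    then show ?thesis
      using inner_add[of "eval a" "eval b"] that subspace_add[OF V(1) that]
      by (simp add: T_def eval_in_model_space[OF \<phi>, symmetric])
  qed
  have T_cmul: "T (cmul c a) = c * T a" if "a \<in> ?V" for c a
  proof -
    have "eval (cmul c a) = (\<lambda>z. c * eval a z)" by (simp add: fun_eq_iff eval_simps)
    then show ?thesis
      using inner_cmult[of "eval a" c] that V(3)[OF that, of c]
      by (simp add: T_def eval_in_model_space[OF \<phi>, symmetric])
  qed
  \<comment> \<open>This is the arithmetic-mean bound for a unit vector, whose image under J has
    norm 1; general vectors are reached by scaling.\<close>
  define C where "C = (1 + (L2_norm \<sigma> h)\<^sup>2) / 2"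
  have T_le: "cmod (T u) \<le> C * norm u" if u: "u \<in> ?V" for u
  proof (cases "u = 0")
    case True
    have "cmul 0 u = u" by (rule ell2_eqI) (simp add: True)
    then have "T u = 0" using T_cmul[OF u, of 0] by simp
    then show ?thesis by (simp add: True)
  next
    case False
    define e where "e = cmul (of_real (inverse (norm u))) u"
    have e: "e \<in> ?V" "norm e = 1" using u False by (simp_all add: e_def V(3) norm_cmul norm_inverse)
    have "cmod (T e) \<le> C"
      using cmod_L2_inner_le[OF J_L2 h, of "eval e"] J_norm[of "eval e"] e
      by (simp add: T_def C_def eval_in_model_space[OF \<phi>] hardy_norm_eq)
    moreover have "u = cmul (of_real (norm u)) e"
      by (rule ell2_eqI) (use False in \<open>simp add: e_def\<close>)
    then have "T u = of_real (norm u) * T e" using T_cmul[OF e(1)] by metis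
    ultimately show ?thesis using mult_right_mono[of "cmod (T e)" C "norm u"] by (simp add: norm_mult mult.commute)
  qed
  obtain v where v: "v \<in> ?V" "\<forall>u\<in>?V. T u = cinner u v"
    using complex_riesz_on_subspace[OF V(1,2) V(3) T_add T_cmul T_le] by blast
  have "L2_inner \<sigma> (J f) h = hardy_inner f (eval v)" if f: "f \<in> model_space \<phi>" for f
  proof -
    have fH: "f \<in> hardy_space" and fV: "hardy_coef f \<in> ?V"
      using f by (simp_all add: model_space_iff[OF \<phi>])
    let ?g = "eval (hardy_coef f)"
    \<comment> \<open>f and its canonical representative ?g may differ off the bidisk. Their
      difference has Hardy norm 0, so the isometry makes its image vanish almost everywhere and both
      give the same inner product with h.\<close>
    define d where "d z = f z - ?g z" for z
    have "d z = eval 0 z" if "z \<in> bidisk" for z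
      using eval_hardy_coef[OF fH that] by (simp add: d_def eval_def cinner_def)
    note d0 = hardy_space_evalI[of d 0, OF this]
    have d: "d \<in> model_space \<phi>" using d0 subspace_0[OF V(1)] by (simp add: model_space_iff[OF \<phi>])
    have g: "?g \<in> model_space \<phi>" using fV by (simp add: eval_in_model_space[OF \<phi>])
    have "L2_norm \<sigma> (J d) = 0" using J_norm[OF d] d0 by (simp add: hardy_norm_eq)
    then have "AE \<zeta> in \<sigma>. J d \<zeta> = 0" by (rule L2_norm_zero_imp_AE_zero[OF J_L2[OF d]])
    then have "L2_inner \<sigma> (J d) h = L2_inner \<sigma> (\<lambda>_. 0) h"
      by (rule L2_inner_cong_AE) (use meas[OF J_L2[OF d]] meas[OF h] in simp_all)
    then have "L2_inner \<sigma> (J d) h = 0" by (simp add: L2_inner_def)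
    moreover have "f = (\<lambda>z. ?g z + d z)" by (simp add: d_def fun_eq_iff)
    ultimately have "L2_inner \<sigma> (J f) h = T (hardy_coef f)"
      using inner_add[OF g d] f unfolding T_def by (metis add.right_neutral)
    then show ?thesis using v fV fH by (simp add: hardy_inner_eq)
  qed
  then show ?thesis using v(1) eval_in_model_space[OF \<phi>] by blast
qed

theorem lemma4p1:
  fixes \<phi> :: "complex \<times> complex \<Rightarrow> complex"
    and \<alpha> :: complex
    and \<sigma> :: "(complex \<times> complex) measure"
    and J :: "(complex \<times> complex \<Rightarrow> complex) \<Rightarrow> (complex \<times> complex \<Rightarrow> complex)"
  assumes "inner_function \<phi>"
    and "\<not> \<phi> constant_on bidisk"
    and "cmod \<alpha> = 1"
    and "clark_measure \<phi> \<alpha> \<sigma>"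
    and "clark_embedding \<phi> \<alpha> \<sigma> J"
  shows "(\<exists>S. is_adjoint \<phi> \<sigma> J S) \<and>
    (\<forall>S. is_adjoint \<phi> \<sigma> J S \<longrightarrow>
      (\<forall>h\<in>L2_space \<sigma>. \<forall>z\<in>bidisk.
        S h z = (1 - cnj \<alpha> * \<phi> z) * (\<integral>\<zeta>. h \<zeta> * szego_kernel \<zeta> z \<partial>\<sigma>)))"
proof (intro conjI allI impI ballI)
  note \<phi> = assms(1) and J = assms(5)
  show "\<exists>S. is_adjoint \<phi> \<sigma> J S"
    using ex_clark_adjoint[OF \<phi> J] unfolding is_adjoint_def by metis
  \<comment> \<open>Taking an arbitrary adjoint shows at the same time that any two adjoints agree
    on the bidisk.\<close>
  fix S h w
  assume S: "is_adjoint \<phi> \<sigma> J S" and h: "h \<in> L2_space \<sigma>" and w: "w \<in> bidisk"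
  have Sh: "S h \<in> model_space \<phi>" using S h by (simp add: is_adjoint_def)
  let ?k = "model_kernel \<phi> w"
  have k: "?k \<in> model_space \<phi>" by (rule model_kernel_in_model_space[OF \<phi> w])
  \<comment> \<open>Quotients of measurable functions are measurable with division by zero giving 0,
    so zeros of the denominator elsewhere in the ambient space do no harm.\<close>
  have szego: "szego_kernel w \<in> borel_measurable \<sigma>"
  proof -
    have "szego_kernel w \<in> borel_measurable borel"
      unfolding szego_kernel_def
      by (intro borel_measurable_divide borel_measurable_continuous_onI continuous_intros)
    then have "szego_kernel w \<in> borel_measurable (restrict_space borel torus)"
      by (rule measurable_restrict_space1)
    moreover have "sets \<sigma> = sets (restrict_space borel torus)"
      using assms(4) by (simp add: clark_measure_def)
    ultimately show ?thesis using measurable_cong_sets by blast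
  qed
  have "S h w = hardy_inner (S h) ?k" by (rule model_kernel_reproducing[OF \<phi> w Sh, symmetric])
  \<comment> \<open>The adjoint relation has the model space element in the first slot, so the
    reproducing formula is conjugated before it is applied.\<close>
  also have "\<dots> = cnj (hardy_inner ?k (S h))"
    using k Sh by (simp add: model_space_iff[OF \<phi>] hardy_inner_eq cinner_commute[symmetric])
  also have "hardy_inner ?k (S h) = L2_inner \<sigma> (J ?k) h"
    using S h k by (simp add: is_adjoint_def)
  also have "\<dots> = L2_inner \<sigma> (\<lambda>\<zeta>. (1 - \<alpha> * cnj (\<phi> w)) * szego_kernel w \<zeta>) h"
  proof (rule L2_inner_cong_AE)
    show "AE \<zeta> in \<sigma>. J ?k \<zeta> = (1 - \<alpha> * cnj (\<phi> w)) * szego_kernel w \<zeta>"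
      using J w by (simp add: clark_embedding_def)
    show "J ?k \<in> borel_measurable \<sigma>" using J k by (simp add: clark_embedding_def L2_space_def)
    show "h \<in> borel_measurable \<sigma>" using h by (simp add: L2_space_def)
  qed (intro borel_measurable_times borel_measurable_const szego)
  also have "cnj \<dots> = (1 - cnj \<alpha> * \<phi> w) * cnj (L2_inner \<sigma> (szego_kernel w) h)"
    by (simp add: L2_inner_cmult)
  \<comment> \<open>Hermitian symmetry of the Szego kernel turns the conjugated
    \<open>szego_kernel w\<close> into the kernel indexed by the integration variable.\<close>
  also have "cnj (L2_inner \<sigma> (szego_kernel w) h) = (\<integral>\<zeta>. h \<zeta> * szego_kernel \<zeta> w \<partial>\<sigma>)"
  proof -
    have "cnj (szego_kernel w \<zeta>) = szego_kernel \<zeta> w" for \<zeta>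
      by (simp add: szego_kernel_def mult.commute)
    then have "(\<integral>\<zeta>. h \<zeta> * szego_kernel \<zeta> w \<partial>\<sigma>) = (\<integral>\<zeta>. cnj (szego_kernel w \<zeta> * cnj (h \<zeta>)) \<partial>\<sigma>)"
      by (simp add: mult.commute)
    also have "\<dots> = cnj (L2_inner \<sigma> (szego_kernel w) h)"
      unfolding L2_inner_def by (rule Bochner_Integration.integral_cnj)
    finally show ?thesis by (rule sym)
  qed
  finally show "S h w = (1 - cnj \<alpha> * \<phi> w) * (\<integral>\<zeta>. h \<zeta> * szego_kernel \<zeta> w \<partial>\<sigma>)" .
qed

end
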